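(* Let $\sigma\in\mathcal S_{0,\infty}$ have a positive infimal dwell-time $T_\sigma:=\inf_{k\ge0}(t_{k+1}-t_k)>0$, and let the growth condition (defined in the context) hold for $\sigma$. The following statements are equivalent: (i) There exist $M\ge1$ and $\alpha>0$ such that $\|U_\sigma(t,s)\|\le Me^{-\alpha(t-s)}$ for all $t\ge s\ge0$. (ii) There exist $p\ge1$ and $b>0$ such that $$\int_s^\infty\|U_\sigma(t,s)x\|^p\,dt\le b^p\|x\|^p$$ for all $s\ge0$ and all $x\in X$. (iii) There exist a functional $V:\mathbb R_{\ge0}\times X\to\mathbb R_{\ge0}$, Lipschitz on bounded subsets of $X$ uniformly in $t$ and piecewise right-continuous in $t$ (see context), and constants $p\ge1$, $c>0$ such that for all $x\in X$ $$V(t,x)\le c\|x\|^p\quad\forall t\ge0,\qquad \underline D^+V(t,x)\le-\|x\|^p\quad\forall t\ge0,\qquad V(t,Jx)-V(t^-,x)\le0\quad\forall t\in\mathbb T_\sigma.$$ Moreover, when (i) holds, an explicit functional witnessing (iii) is $$V(t,x):=\int_t^\infty\|U_\sigma(s,t)x\|^p\,ds.$$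
   Context: Setting. $X$ is a Banach space with norm $\|\cdot\|$; $A:D(A)\subset X\to X$ generates a strongly continuous ($C_0$) semigroup $(S(t))_{t\ge0}$ on $X$; $J\in L(X)$ is bounded, $J\neq0$, $JD(A)\subset D(A)$. $\mathcal S_{0,\infty}$ is the set of sequences $\sigma=\{t_k\}_{k\ge1}$ with, setting $t_0:=0$, $t_{k+1}>t_k$ for all $k\ge0$ and $t_k\to\infty$; $\mathbb T_\sigma:=\{t_k:k\ge1\}$. The impulsive system is $\dot x(t)=Ax(t)$ for $t\notin\mathbb T_\sigma$, $x(t)=Jx(t^-)$ for $t\in\mathbb T_\sigma$. Its propagator $U_\sigma(t,s)$, $t\ge s\ge0$, is: $U_\sigma(t,s)=S(t-s)$ if $(s,t]\cap\mathbb T_\sigma=\varnothing$; otherwise, if $t_l<\dots<t_m$ are the impulse times in $(s,t]$, $U_\sigma(t,s)=S(t-t_m)JS(t_m-t_{m-1})J\cdots JS(t_l-s)$. $\kappa_\sigma(t,s):=\#(\mathbb T_\sigma\cap(s,t])$. Growth condition for $\sigma$: there exist a piecewise continuous $g:\mathbb R_{\ge0}\to\mathbb R_{>0}$ bounded below by some $c_0>0$, and $\mu>1$, such that $\|U_\sigma(t,s)x\|\le g(t-s)\mu^{\kappa_\sigma(t,s)}\|x\|$ for all $t\ge s\ge0$, $x\in X$, and $G:=\sup_{0\le\tau<\bar T}g(\tau)<\infty$, where $\bar T:=\sup_{k\ge0}(t_{k+1}-t_k)\in(0,\infty]$. Functionals. $V$ is Lipschitz on bounded subsets of $X$ uniformly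 in $t$ if for every $r>0$ there is $L_r>0$ with $|V(t,x)-V(t,y)|\le L_r\|x-y\|$ for all $\|x\|<r$, $\|y\|<r$, $t\ge0$. Piecewise right-continuous in $t$ means: for each $x$, $t\mapsto V(t,x)$ is continuous on each $[t_k,t_{k+1})$, $k\ge0$, and has left limits $V(t_k^-,x):=\lim_{t\uparrow t_k}V(t,x)$ at impulse times. The lower right-hand Dini derivative along the flow is $$\underline D^+V(t,x):=\liminf_{h\downarrow0}\frac{V(t+h,S(h)x)-V(t,x)}{h}.$$ *)

theory Defs
  imports "HOL-Analysis.Analysis"
begin

text \<open>Operators are bounded linear maps \<open>'a \<Rightarrow>\<^sub>L 'a\<close> of a (real) Banach space; a complex
  Banach space is covered through its underlying real one. Objects indexed by \<open>t \<ge> 0\<close> are functions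
  on \<^typ>\<open>real\<close> whose values at negative times are irrelevant.\<close>

definition C0_semigroup :: "(real \<Rightarrow> 'a::banach \<Rightarrow>\<^sub>L 'a) \<Rightarrow> bool" where
  "C0_semigroup S \<longleftrightarrow>
     S 0 = id_blinfun \<and>
     (\<forall>s\<ge>0. \<forall>t\<ge>0. S (s + t) = S s o\<^sub>L S t) \<and>
     (\<forall>x. ((\<lambda>h. S h x) \<longlongrightarrow> x) (at_right 0))"

definition generates ::
    "'a::banach set \<Rightarrow> ('a \<Rightarrow> 'a) \<Rightarrow> (real \<Rightarrow> 'a \<Rightarrow>\<^sub>L 'a) \<Rightarrow> bool" where
  "generates DA A S \<longleftrightarrow>
     C0_semigroup S \<and>
     DA = {x. \<exists>y. ((\<lambda>h. (S h x - x) /\<^sub>R h) \<longlongrightarrow> y) (at_right 0)} \<and>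
     (\<forall>x\<in>DA. ((\<lambda>h. (S h x - x) /\<^sub>R h) \<longlongrightarrow> A x) (at_right 0))"

text \<open>A sequence \<open>\<sigma> = {t\<^sub>k}\<close>, \<open>k \<ge> 1\<close>, is stored together with the convention \<open>t\<^sub>0 = 0\<close>; the
  index 0 is not an impulse time.\<close>

definition impulse_sequence :: "(nat \<Rightarrow> real) \<Rightarrow> bool" where
  "impulse_sequence \<sigma> \<longleftrightarrow>
     \<sigma> 0 = 0 \<and> (\<forall>k. \<sigma> k < \<sigma> (Suc k)) \<and> filterlim \<sigma> at_top sequentially"

definition impulse_times :: "(nat \<Rightarrow> real) \<Rightarrow> real set" where
  "impulse_times \<sigma> = \<sigma> ` {1..}"

definition inf_dwell :: "(nat \<Rightarrow> real) \<Rightarrow> real" where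
  "inf_dwell \<sigma> = (INF k. \<sigma> (Suc k) - \<sigma> k)"

definition sup_dwell :: "(nat \<Rightarrow> real) \<Rightarrow> ereal" where
  "sup_dwell \<sigma> = (SUP k. ereal (\<sigma> (Suc k) - \<sigma> k))"

definition impulse_count :: "(nat \<Rightarrow> real) \<Rightarrow> real \<Rightarrow> real \<Rightarrow> nat" where
  "impulse_count \<sigma> t s = card (impulse_times \<sigma> \<inter> {s<..t})"

text \<open>\<open>propagate S J t s [\<tau>\<^sub>l, \<dots>, \<tau>\<^sub>m]\<close> is
  \<open>S (t - \<tau>\<^sub>m) J S (\<tau>\<^sub>m - \<tau>\<^sub>m\<^sub>-\<^sub>1) J \<dots> J S (\<tau>\<^sub>l - s)\<close>.\<close>

fun propagate ::
    "(real \<Rightarrow> 'a::banach \<Rightarrow>\<^sub>L 'a) \<Rightarrow> ('a \<Rightarrow>\<^sub>L 'a) \<Rightarrow> real \<Rightarrow> real \<Rightarrow> real list \<Rightarrow> 'a \<Rightarrow>\<^sub>L 'a" where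
  "propagate S J t s [] = S (t - s)"
| "propagate S J t s (\<tau> # \<tau>s) = propagate S J t \<tau> \<tau>s o\<^sub>L J o\<^sub>L S (\<tau> - s)"

definition propagator ::
    "(real \<Rightarrow> 'a::banach \<Rightarrow>\<^sub>L 'a) \<Rightarrow> ('a \<Rightarrow>\<^sub>L 'a) \<Rightarrow> (nat \<Rightarrow> real) \<Rightarrow> real \<Rightarrow> real \<Rightarrow> 'a \<Rightarrow>\<^sub>L 'a" where
  "propagator S J \<sigma> t s =
     propagate S J t s (sorted_list_of_set (impulse_times \<sigma> \<inter> {s<..t}))"

text \<open>Piecewise continuity on \<open>[0, \<infinity>)\<close>: finitely many discontinuities in every bounded interval,
  and finite one-sided limits everywhere.\<close>

definition piecewise_continuous :: "(real \<Rightarrow> real) \<Rightarrow> bool" where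
  "piecewise_continuous g \<longleftrightarrow>
     (\<forall>b>0. \<exists>F. finite F \<and> continuous_on ({0..b} - F) g) \<and>
     (\<forall>\<tau>\<ge>0. \<exists>l. (g \<longlongrightarrow> l) (at_right \<tau>)) \<and>
     (\<forall>\<tau>>0. \<exists>l. (g \<longlongrightarrow> l) (at_left \<tau>))"

definition growth_condition ::
    "(real \<Rightarrow> 'a::banach \<Rightarrow>\<^sub>L 'a) \<Rightarrow> ('a \<Rightarrow>\<^sub>L 'a) \<Rightarrow> (nat \<Rightarrow> real) \<Rightarrow> bool" where
  "growth_condition S J \<sigma> \<longleftrightarrow>
     (\<exists>g c\<^sub>0 \<mu>. piecewise_continuous g \<and> c\<^sub>0 > 0 \<and> (\<forall>\<tau>\<ge>0. c\<^sub>0 \<le> g \<tau>) \<and> \<mu> > 1 \<and>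
        (\<forall>s\<ge>0. \<forall>t\<ge>s. \<forall>x.
           norm (propagator S J \<sigma> t s x) \<le> g (t - s) * \<mu> ^ impulse_count \<sigma> t s * norm x) \<and>
        bdd_above (g ` {\<tau>. 0 \<le> \<tau> \<and> ereal \<tau> < sup_dwell \<sigma>}))"

definition exp_stable ::
    "(real \<Rightarrow> 'a::banach \<Rightarrow>\<^sub>L 'a) \<Rightarrow> ('a \<Rightarrow>\<^sub>L 'a) \<Rightarrow> (nat \<Rightarrow> real) \<Rightarrow> bool" where
  "exp_stable S J \<sigma> \<longleftrightarrow>
     (\<exists>M\<ge>1. \<exists>\<alpha>>0. \<forall>s\<ge>0. \<forall>t\<ge>s. norm (propagator S J \<sigma> t s) \<le> M * exp (- \<alpha> * (t - s)))"

text \<open>Integrability is required explicitly since Bochner integrals of non-integrable functions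
  are 0 in HOL.\<close>

definition integrally_stable ::
    "(real \<Rightarrow> 'a::banach \<Rightarrow>\<^sub>L 'a) \<Rightarrow> ('a \<Rightarrow>\<^sub>L 'a) \<Rightarrow> (nat \<Rightarrow> real) \<Rightarrow> bool" where
  "integrally_stable S J \<sigma> \<longleftrightarrow>
     (\<exists>p\<ge>1. \<exists>b>0. \<forall>s\<ge>0. \<forall>x.
        set_integrable lborel {s..} (\<lambda>t. norm (propagator S J \<sigma> t s x) powr p) \<and>
        (LINT t:{s..}|lborel. norm (propagator S J \<sigma> t s x) powr p) \<le> b powr p * norm x powr p)"

definition uniformly_lipschitz_on_bounded :: "(real \<Rightarrow> 'a::banach \<Rightarrow> real) \<Rightarrow> bool" where
  "uniformly_lipschitz_on_bounded V \<longleftrightarrow>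
     (\<forall>r>0. \<exists>L>0. \<forall>t\<ge>0. \<forall>x y. norm x < r \<longrightarrow> norm y < r \<longrightarrow>
        \<bar>V t x - V t y\<bar> \<le> L * norm (x - y))"

definition piecewise_right_continuous ::
    "(nat \<Rightarrow> real) \<Rightarrow> (real \<Rightarrow> 'a::banach \<Rightarrow> real) \<Rightarrow> bool" where
  "piecewise_right_continuous \<sigma> V \<longleftrightarrow>
     (\<forall>x. (\<forall>k. continuous_on {\<sigma> k..<\<sigma> (Suc k)} (\<lambda>t. V t x)) \<and>
          (\<forall>t\<in>impulse_times \<sigma>. \<exists>l. ((\<lambda>\<tau>. V \<tau> x) \<longlongrightarrow> l) (at_left t)))"

definition lower_dini ::
    "(real \<Rightarrow> 'a::banach \<Rightarrow>\<^sub>L 'a) \<Rightarrow> (real \<Rightarrow> 'a \<Rightarrow> real) \<Rightarrow> real \<Rightarrow> 'a \<Rightarrow> ereal" where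
  "lower_dini S V t x = Liminf (at_right 0) (\<lambda>h. ereal ((V (t + h) (S h x) - V t x) / h))"

definition lyapunov_functional ::
    "(real \<Rightarrow> 'a::banach \<Rightarrow>\<^sub>L 'a) \<Rightarrow> ('a \<Rightarrow>\<^sub>L 'a) \<Rightarrow> (nat \<Rightarrow> real) \<Rightarrow> real \<Rightarrow> real \<Rightarrow>
     (real \<Rightarrow> 'a \<Rightarrow> real) \<Rightarrow> bool" where
  "lyapunov_functional S J \<sigma> p c V \<longleftrightarrow>
     (\<forall>t\<ge>0. \<forall>x. 0 \<le> V t x) \<and>
     uniformly_lipschitz_on_bounded V \<and>
     piecewise_right_continuous \<sigma> V \<and>
     (\<forall>x. (\<forall>t\<ge>0. V t x \<le> c * norm x powr p) \<and>
          (\<forall>t\<ge>0. lower_dini S V t x \<le> ereal (- (norm x powr p))) \<and>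
          (\<forall>t\<in>impulse_times \<sigma>. V t (J x) - Lim (at_left t) (\<lambda>\<tau>. V \<tau> x) \<le> 0))"

definition integral_functional ::
    "(real \<Rightarrow> 'a::banach \<Rightarrow>\<^sub>L 'a) \<Rightarrow> ('a \<Rightarrow>\<^sub>L 'a) \<Rightarrow> (nat \<Rightarrow> real) \<Rightarrow> real \<Rightarrow> real \<Rightarrow> 'a \<Rightarrow> real" where
  "integral_functional S J \<sigma> p t x = (LINT s:{t..}|lborel. norm (propagator S J \<sigma> s t x) powr p)"

end

theory Submission
  imports Defs
begin

text \<open>Besides the strong continuity of \<open>S\<close>, two facts about the propagator \<open>U\<close> matter: the cocycle identity
  \<open>U t s = U t r o\<^sub>L U r s\<close>, and a bound \<open>K\<close> for all \<open>U t s\<close> with \<open>t - s\<close> at most some \<open>h > 0\<close>. The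
  latter is where dwell time and growth condition meet: a window of half the infimal dwell-time
  contains at most one impulse, and its length stays strictly below the supremal dwell-time, so that
  \<open>G * \<mu>\<close> bounds the propagator there (\<open>short_time_bound\<close>).

  From integral to exponential stability the argument is Datko's. If \<open>U t \<tau>\<close> is bounded by \<open>C\<close> for
  all \<open>\<tau>\<close> between \<open>a\<close> and \<open>t\<close>, then \<open>norm (U t s x)\<close> is at most \<open>C\<close> times each value of the
  trajectory on that window, hence at most \<open>C\<close> times its average in the sense of \<open>L\<^sup>p\<close>
  (\<open>norm_U_le_by_averaging\<close>). With a window of length \<open>h\<close> this bounds \<open>U\<close> uniformly; with the uniform
  bound the window may be all of \<open>[s, t]\<close>, and the factor \<open>(t - s) powr (1 / p)\<close> in the denominator
  makes \<open>U\<close> a contraction over some fixed time \<open>H\<close>, which iterates to exponential decay.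

  From a Lyapunov functional to integral stability: along a trajectory \<open>x\<close> without impulses the
  function \<open>V t (x t) + \<integral> norm (x \<tau>) powr p\<close> is continuous and its lower right Dini derivative
  is nonpositive, so it decreases (\<open>nonincreasing_if_lower_dini_nonpos\<close>); the jump condition says that
  it does not increase at an impulse either. Since \<open>V\<close> is nonnegative, the integral over every
  bounded interval is at most \<open>V s (x s)\<close>, uniformly in the interval (\<open>lyapunov_dissipation\<close>).

  From exponential stability to the explicit functional everything rests on the identity
  \<open>V t x = \<integral>\<^bsub>t..u\<^esub> norm (U s t x) powr p + V u (U u t x)\<close> (\<open>V_split\<close>). It yields the Dini
  derivative directly. Together with the Lipschitz bound it compares \<open>V t x\<close> with \<open>V u x\<close> if no
  impulse lies in between, and with \<open>V u (J x)\<close> if \<open>u\<close> is the next impulse. The left limit at an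
  impulse is therefore \<open>V u (J x)\<close> itself, and the jump condition holds with equality.\<close>

section \<open>Real analysis\<close>

text \<open>Tilting \<open>g\<close> by a small slope \<open>\<epsilon>\<close> turns the hypothesis into a strict one. If the tilted function
  ended above its initial value, consider the last point at which it does not exceed that value:
  to its right all difference quotients would be positive.\<close>

lemma nonincreasing_if_lower_dini_nonpos:
  fixes g :: "real \<Rightarrow> real"
  assumes ab: "a \<le> b" and cont: "continuous_on {a..b} g"
    and dini: "\<And>t \<epsilon>. a \<le> t \<Longrightarrow> t < b \<Longrightarrow> 0 < \<epsilon> \<Longrightarrow>
                 \<exists>\<^sub>F v in at_right t. (g v - g t) / (v - t) < \<epsilon>"
  shows "g b \<le> g a"
proof (cases "a = b")
  case False
  with ab have ab: "a < b" by simp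
  have tilted: "g b - g a \<le> \<epsilon> * (b - a)" if \<epsilon>: "0 < \<epsilon>" for \<epsilon>
  proof (rule ccontr)
    define k where "k t = g t - \<epsilon> * (t - a)" for t
    assume "\<not> ?thesis"
    then have lt: "k a < k b" by (simp add: k_def)
    have kcont: "continuous_on {a..b} k"
      unfolding k_def by (intro continuous_intros cont)
    define Y where "Y = {t \<in> {a..b}. k t \<le> k a}"
    have "closed Y"
      unfolding Y_def
      by (intro continuous_on_closed_Collect_le[OF kcont] continuous_on_const closed_atLeastAtMost)
    moreover have bdd: "bdd_above Y" by (auto simp: Y_def bdd_above_def)
    moreover have "a \<in> Y" using ab by (simp add: Y_def)
    ultimately have top: "Sup Y \<in> Y" by (intro closed_contains_Sup) auto
    define t where "t = Sup Y"
    have t: "a \<le> t" "t < b" "k t \<le> k a"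
      using top lt by (auto simp: Y_def t_def order_less_le)
    have above: "k a < k v" if "t < v" "v \<le> b" for v
    proof (rule ccontr)
      assume "\<not> k a < k v"
      then have "v \<in> Y" using that t by (simp add: Y_def)
      then have "v \<le> t" unfolding t_def by (intro cSup_upper bdd)
      with that show False by simp
    qed
    have "\<forall>\<^sub>F v in at_right t. v \<in> {t<..<b}"
      using t(2) by (intro eventually_at_right_field[THEN iffD2] exI[of _ b]) auto
    with dini[OF t(1,2) \<epsilon>] have "\<exists>\<^sub>F v in at_right t. (g v - g t) / (v - t) < \<epsilon> \<and> v \<in> {t<..<b}"
      by (rule frequently_eventually_frequently)
    then obtain v where v: "(g v - g t) / (v - t) < \<epsilon>" "t < v" "v < b"
      by (auto dest: frequently_ex)
    then have "g v - g t < \<epsilon> * (v - t)" by (simp add: pos_divide_less_eq)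
    then have "k v < k t" by (simp add: k_def algebra_simps)
    with above[of v] v t show False by simp
  qed
  show ?thesis
  proof (rule field_le_epsilon)
    fix e :: real assume "0 < e"
    with tilted[of "e / (b - a)"] ab show "g b \<le> g a + e" by simp
  qed
qed simp

lemma abs_powr_diff_le:
  fixes a b R p :: real
  assumes "1 \<le> p" "0 \<le> a" "a \<le> R" "0 \<le> b" "b \<le> R"
  shows "\<bar>a powr p - b powr p\<bar> \<le> p * R powr (p - 1) * \<bar>a - b\<bar>"
proof -
  have *: "b powr p - a powr p \<le> p * R powr (p - 1) * (b - a)"
    if ab: "0 \<le> a" "a < b" "b \<le> R" for a b :: real
  proof -
    have d: "((\<lambda>x. x powr p) has_real_derivative p * x powr (p - 1)) (at x)" if "a < x" for x
      using that ab by (auto intro!: derivative_eq_intros)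
    have "\<exists>l z. a < z \<and> z < b \<and> ((\<lambda>x. x powr p) has_real_derivative l) (at z) \<and>
        b powr p - a powr p = (b - a) * l"
      using ab assms(1)
      by (intro MVT continuous_on_powr' continuous_intros)
         (auto simp: real_differentiable_def intro: d)
    then obtain l z where z: "a < z" "z < b" "((\<lambda>x. x powr p) has_real_derivative l) (at z)"
        "b powr p - a powr p = (b - a) * l" by blast
    have "l = p * z powr (p - 1)" using DERIV_unique[OF z(3) d[OF z(1)]] .
    moreover have "z powr (p - 1) \<le> R powr (p - 1)"
      using z ab assms(1) by (intro powr_mono2) auto
    ultimately have "l \<le> p * R powr (p - 1)" using assms(1) by simp
    then have "(b - a) * l \<le> (b - a) * (p * R powr (p - 1))"
      using ab by (intro mult_left_mono) auto
    with z(4) show ?thesis by (simp add: mult.commute)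
  qed
  have "x powr p \<le> y powr p" if "0 \<le> x" "x \<le> y" for x y
    using that assms(1) by (intro powr_mono2) auto
  with assms have mono: "a \<le> b \<Longrightarrow> a powr p \<le> b powr p" "b \<le> a \<Longrightarrow> b powr p \<le> a powr p"
    by blast+
  show ?thesis
  proof (cases a b rule: linorder_cases)
    case less
    then show ?thesis using *[of a b] mono assms by simp
  next
    case greater
    then show ?thesis using *[of b a] mono assms by simp
  qed simp
qed

text \<open>Monotone convergence along \<open>{s..<s + n}\<close>. Measurability on the half-line comes for free, as the
  restrictions to bounded intervals are measurable.\<close>

lemma halfline_integrable_if_bounded:
  fixes f :: "real \<Rightarrow> real"
  assumes int: "\<And>t. s \<le> t \<Longrightarrow> set_integrable lborel {s..<t} f"
    and nonneg: "\<And>\<tau>. s \<le> \<tau> \<Longrightarrow> 0 \<le> f \<tau>"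
    and bound: "\<And>t. s \<le> t \<Longrightarrow> (LINT \<tau>:{s..<t}|lborel. f \<tau>) \<le> C"
  shows "set_integrable lborel {s..} f" "(LINT \<tau>:{s..}|lborel. f \<tau>) \<le> C"
proof -
  define F where "F n \<tau> = indicator {s..<s + real n} \<tau> *\<^sub>R f \<tau>" for n \<tau>
  have Fint: "integrable lborel (F n)" for n
    using int[of "s + real n"] by (simp add: set_integrable_def F_def[abs_def])
  have Fmono: "mono (\<lambda>n. F n \<tau>)" for \<tau>
    by (rule monoI) (auto simp: F_def nonneg split: split_indicator)
  have Flim: "(\<lambda>n. F n \<tau>) \<longlonglongrightarrow> indicator {s..} \<tau> *\<^sub>R f \<tau>" for \<tau>
  proof (rule tendsto_eventually)
    have "\<forall>\<^sub>F n in sequentially. \<tau> - s < real n"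
      using filterlim_real_sequentially by (simp add: filterlim_at_top_dense)
    then show "\<forall>\<^sub>F n in sequentially. F n \<tau> = indicator {s..} \<tau> *\<^sub>R f \<tau>"
      by eventually_elim (auto simp: F_def split: split_indicator)
  qed
  have Fle: "integral\<^sup>L lborel (F n) \<le> C" for n
    using bound[of "s + real n"] by (simp add: set_lebesgue_integral_def F_def[abs_def])
  have "incseq (\<lambda>n. integral\<^sup>L lborel (F n))"
    by (intro monoI integral_mono Fint) (rule monoD[OF Fmono])
  then obtain I where I: "(\<lambda>n. integral\<^sup>L lborel (F n)) \<longlonglongrightarrow> I"
    using Fle by (blast elim: incseq_convergent[of _ C])
  have meas: "(\<lambda>\<tau>. indicator {s..} \<tau> *\<^sub>R f \<tau>) \<in> borel_measurable lborel"
    by (rule borel_measurable_LIMSEQ_real[OF Flim borel_measurable_integrable[OF Fint]])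
  show "set_integrable lborel {s..} f"
    unfolding set_integrable_def
    by (rule integrable_monotone_convergence[OF Fint AE_I2[OF Fmono] AE_I2[OF Flim] I meas])
  have "(LINT \<tau>:{s..}|lborel. f \<tau>) = I"
    unfolding set_lebesgue_integral_def
    by (rule integral_monotone_convergence[OF Fint AE_I2[OF Fmono] AE_I2[OF Flim] I meas])
  with I Fle show "(LINT \<tau>:{s..}|lborel. f \<tau>) \<le> C"
    by (auto intro: LIMSEQ_le_const2)
qed

lemma set_integral_mono_subset:
  fixes f :: "'a \<Rightarrow> real"
  assumes "set_integrable M B f" "A \<in> sets M" "A \<subseteq> B" "\<And>x. x \<in> B \<Longrightarrow> 0 \<le> f x"
  shows "(LINT x:A|M. f x) \<le> (LINT x:B|M. f x)"
  using assms set_integrable_subset[OF assms(1-3)]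
  unfolding set_integrable_def set_lebesgue_integral_def
  by (intro integral_mono) (auto split: split_indicator)

lemma exp_decay_halfline_integral:
  fixes a s :: real
  assumes "0 < a"
  shows "set_integrable lborel {s..} (\<lambda>t. exp (- a * (t - s)))"
    and "(LINT t:{s..}|lborel. exp (- a * (t - s))) \<le> 1 / a"
proof -
  let ?f = "\<lambda>t. exp (- a * (t - s))"
  have cont: "continuous_on {s..t} ?f" for t by (intro continuous_intros)
  have int: "set_integrable lborel {s..<t} ?f" for t
    by (rule set_integrable_subset[OF borel_integrable_atLeastAtMost'[OF cont[of t]]]) auto
  have bound: "(LINT \<tau>:{s..<t}|lborel. ?f \<tau>) \<le> 1 / a" if "s \<le> t" for t
  proof -
    have "(LINT \<tau>:{s..<t}|lborel. ?f \<tau>) \<le> (LINT \<tau>:{s..t}|lborel. ?f \<tau>)"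
      by (rule set_integral_mono_subset[OF borel_integrable_atLeastAtMost'[OF cont]]) auto
    also have "\<dots> = integral {s..t} ?f"
      by (rule set_borel_integral_eq_integral[OF borel_integrable_atLeastAtMost'[OF cont]])
    also have "\<dots> = (- ?f t / a) - (- ?f s / a)"
      using that assms
      by (intro integral_unique fundamental_theorem_of_calculus)
         (auto simp flip: has_real_derivative_iff_has_vector_derivative intro!: derivative_eq_intros)
    also have "\<dots> \<le> 1 / a" using assms by simp
    finally show ?thesis .
  qed
  show "set_integrable lborel {s..} ?f" "(LINT t:{s..}|lborel. ?f t) \<le> 1 / a"
    by (rule halfline_integrable_if_bounded[OF int _ bound]; simp)+
qed

lemma length_mult_le_set_integral:
  fixes f :: "real \<Rightarrow> real"
  assumes int: "set_integrable lborel A f" and sub: "{a..<b} \<subseteq> A" "a \<le> b"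
    and nonneg: "\<And>\<tau>. \<tau> \<in> A \<Longrightarrow> 0 \<le> f \<tau>"
    and lower: "\<And>\<tau>. a \<le> \<tau> \<Longrightarrow> \<tau> < b \<Longrightarrow> m \<le> f \<tau>"
  shows "(b - a) * m \<le> (LINT \<tau>:A|lborel. f \<tau>)"
proof -
  have "(b - a) * m = (LINT \<tau>:{a..<b}|lborel. m)"
    using sub by (simp add: set_lebesgue_integral_def)
  also have "\<dots> \<le> (LINT \<tau>:{a..<b}|lborel. f \<tau>)"
  proof (intro set_integral_mono set_integrable_subset[OF int _ sub(1)])
    show "set_integrable lborel {a..<b} (\<lambda>_. m)"
      unfolding set_integrable_def
      using sub(2) by (intro integrable_scaleR_left integrable_real_indicator) auto
  qed (use lower in auto)
  also have "\<dots> \<le> (LINT \<tau>:A|lborel. f \<tau>)"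
    by (rule set_integral_mono_subset[OF int _ sub(1) nonneg]) auto
  finally show ?thesis .
qed

text \<open>The semigroup gives control only forward in time, in terms of \<open>S h x - x\<close> for \<open>h > 0\<close>. A modulus
  that depends only on the gap between an earlier and a later time gives two-sided continuity.\<close>

lemma continuous_on_if_one_sided_modulus:
  fixes f :: "real \<Rightarrow> 'b::metric_space" and \<eta> :: "real \<Rightarrow> real"
  assumes lim: "(\<eta> \<longlongrightarrow> 0) (at_right 0)"
    and le: "\<And>t u. t \<in> A \<Longrightarrow> u \<in> A \<Longrightarrow> t < u \<Longrightarrow> dist (f t) (f u) \<le> \<eta> (u - t)"
  shows "continuous_on A f"
proof (rule continuous_onI)
  fix t e assume t: "t \<in> A" and "0 < (e :: real)"
  with lim have "\<forall>\<^sub>F v in at_right 0. \<eta> v < e" by (intro order_tendstoD)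
  then obtain d where d: "0 < d" "\<And>v. 0 < v \<Longrightarrow> v < d \<Longrightarrow> \<eta> v < e"
    by (auto simp: eventually_at_right_field)
  have "dist (f u) (f t) \<le> e" if u: "u \<in> A" "dist u t < d" for u
  proof (cases t u rule: linorder_cases)
    case less
    with u d(2)[of "u - t"] le[OF t u(1)] show ?thesis by (simp add: dist_real_def dist_commute)
  next
    case equal
    with \<open>0 < e\<close> show ?thesis by simp
  next
    case greater
    with u d(2)[of "t - u"] le[OF u(1) t] show ?thesis by (simp add: dist_real_def)
  qed
  with d(1) show "\<exists>d>0. \<forall>x'\<in>A. dist x' t < d \<longrightarrow> dist (f x') (f t) \<le> e" by blast
qed

lemma powr_le_powr_iff:
  fixes x y p :: real
  assumes "0 < p" "0 \<le> x" "0 \<le> y"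
  shows "x powr p \<le> y powr p \<longleftrightarrow> x \<le> y"
  using assms powr_mono2[of p x y] powr_less_mono2[of p y x] by linarith

lemma filterlim_diff_at_left: "filterlim (\<lambda>t. \<tau> - t) (at_right 0) (at_left (\<tau> :: real))"
proof -
  have "((\<lambda>t. \<tau> - t) \<longlongrightarrow> 0) (at_left \<tau>)"
    using tendsto_diff[OF tendsto_const[of \<tau>] tendsto_ident_at[of \<tau> "{..<\<tau>}"]] by simp
  then show ?thesis
    by (rule tendsto_imp_filterlim_at_right) (auto simp: eventually_at_filter)
qed

lemma frequently_lt_if_Liminf_le:
  fixes X :: "'a \<Rightarrow> real" and C :: real
  assumes "Liminf F (\<lambda>n. ereal (X n)) \<le> ereal C" "0 < \<epsilon>"
  shows "\<exists>\<^sub>F n in F. X n < C + \<epsilon>"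
proof (rule ccontr)
  assume "\<not> ?thesis"
  then have "\<forall>\<^sub>F n in F. ereal (C + \<epsilon>) \<le> ereal (X n)"
    by (simp add: not_frequently not_less)
  then have "ereal (C + \<epsilon>) \<le> Liminf F (\<lambda>n. ereal (X n))" by (rule Liminf_bounded)
  also note assms(1)
  finally have "ereal (C + \<epsilon>) \<le> ereal C" .
  with assms(2) show False by simp
qed

lemma Liminf_le_if_eventually_le:
  fixes X :: "'a \<Rightarrow> real" and C :: real
  assumes "F \<noteq> bot" "\<And>\<epsilon>. 0 < \<epsilon> \<Longrightarrow> \<forall>\<^sub>F n in F. X n \<le> C + \<epsilon>"
  shows "Liminf F (\<lambda>n. ereal (X n)) \<le> ereal C"
proof (rule ereal_le_epsilon2)
  fix \<epsilon> :: real assume "0 < \<epsilon>"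
  have "Liminf F (\<lambda>n. ereal (X n)) \<le> Limsup F (\<lambda>n. ereal (X n))"
    using assms(1) by (rule Liminf_le_Limsup)
  also have "\<dots> \<le> ereal (C + \<epsilon>)"
    using assms(2)[OF \<open>0 < \<epsilon>\<close>] by (intro Limsup_bounded) simp
  finally show "Liminf F (\<lambda>n. ereal (X n)) \<le> ereal C + ereal \<epsilon>" by simp
qed

text \<open>The Lipschitz bound is uniform in time, so that evaluating \<open>V u\<close> at \<open>x u\<close> instead of \<open>x0\<close> costs at
  most \<open>L * norm (x u - x0)\<close>; limits in time at a fixed state become limits along trajectories.\<close>

lemma tendsto_along_trajectory:
  fixes V :: "real \<Rightarrow> 'a::banach \<Rightarrow> real"
  assumes lip: "uniformly_lipschitz_on_bounded V"
    and pos: "\<forall>\<^sub>F u in F. 0 \<le> u" and x: "(x \<longlongrightarrow> x0) F" and V: "((\<lambda>u. V u x0) \<longlongrightarrow> l) F"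
  shows "((\<lambda>u. V u (x u)) \<longlongrightarrow> l) F"
proof -
  define r where "r = norm x0 + 1"
  have r: "0 < r" "norm x0 < r" by (auto simp: r_def add_nonneg_pos)
  obtain L where L: "\<forall>u\<ge>0. \<forall>y z. norm y < r \<longrightarrow> norm z < r \<longrightarrow> \<bar>V u y - V u z\<bar> \<le> L * norm (y - z)"
    using lip r(1) unfolding uniformly_lipschitz_on_bounded_def by blast
  have "((\<lambda>u. L * norm (x u - x0)) \<longlongrightarrow> 0) F"
    using x by (intro tendsto_mult_right_zero tendsto_norm_zero LIM_zero)
  moreover have "\<forall>\<^sub>F u in F. norm (x u) < r"
    using order_tendstoD(2)[OF tendsto_norm[OF x] r(2)] .
  then have "\<forall>\<^sub>F u in F. norm (V u (x u) - V u x0) \<le> L * norm (x u - x0)"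
    using pos by eventually_elim (use L r(2) in auto)
  ultimately have "((\<lambda>u. V u (x u) - V u x0) \<longlongrightarrow> 0) F"
    by (rule Lim_null_comparison[rotated])
  from tendsto_add[OF this V] show ?thesis by simp
qed

section \<open>Impulse times and the propagator\<close>

lemma blinfun_compose_assoc: "(f o\<^sub>L g) o\<^sub>L h = f o\<^sub>L (g o\<^sub>L h)"
  by (rule blinfun_eqI) simp

locale impulsive_system =
  fixes S :: "real \<Rightarrow> 'a::banach \<Rightarrow>\<^sub>L 'a" and J :: "'a \<Rightarrow>\<^sub>L 'a" and \<sigma> :: "nat \<Rightarrow> real"
  assumes semigroup: "C0_semigroup S"
    and seq: "impulse_sequence \<sigma>"
    and dwell: "inf_dwell \<sigma> > 0"
    and growth: "growth_condition S J \<sigma>"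
begin

abbreviation U :: "real \<Rightarrow> real \<Rightarrow> 'a \<Rightarrow>\<^sub>L 'a" where
  "U \<equiv> propagator S J \<sigma>"

abbreviation impulses :: "real set" where
  "impulses \<equiv> impulse_times \<sigma>"

lemma S_0 [simp]: "S 0 = id_blinfun"
  using semigroup by (simp add: C0_semigroup_def)

lemma S_add: "0 \<le> s \<Longrightarrow> 0 \<le> t \<Longrightarrow> S (s + t) = S s o\<^sub>L S t"
  using semigroup by (simp add: C0_semigroup_def)

lemma S_apply_diff: "s \<le> r \<Longrightarrow> r \<le> t \<Longrightarrow> S (t - r) (S (r - s) x) = S (t - s) x"
  using S_add[of "t - r" "r - s"] by (simp flip: blinfun_apply_blinfun_compose)

lemma S_tendsto_0: "((\<lambda>h. S h x) \<longlongrightarrow> x) (at_right 0)"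
  using semigroup by (simp add: C0_semigroup_def)

lemma \<sigma>_0 [simp]: "\<sigma> 0 = 0"
  using seq by (simp add: impulse_sequence_def)

lemma strict_mono_\<sigma>: "strict_mono \<sigma>"
  using seq by (simp add: impulse_sequence_def strict_mono_Suc_iff)

lemma \<sigma>_nonneg: "0 \<le> \<sigma> k"
  using strict_mono_less_eq[OF strict_mono_\<sigma>, of 0 k] by simp

lemma finite_impulses: "finite (impulses \<inter> {s<..t})"
proof -
  have "\<forall>\<^sub>F k in sequentially. t < \<sigma> k"
    using seq by (simp add: impulse_sequence_def filterlim_at_top_dense)
  then obtain N where N: "\<And>k. N \<le> k \<Longrightarrow> t < \<sigma> k"
    by (auto simp: eventually_sequentially)
  have "impulses \<inter> {s<..t} \<subseteq> \<sigma> ` {..<N}"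
  proof
    fix \<tau> assume "\<tau> \<in> impulses \<inter> {s<..t}"
    then obtain k where "\<tau> = \<sigma> k" "\<sigma> k \<le> t" by (auto simp: impulse_times_def)
    with N[of k] show "\<tau> \<in> \<sigma> ` {..<N}" by (cases "k < N") auto
  qed
  then show ?thesis by (rule finite_subset) simp
qed

lemma current_interval:
  assumes "0 \<le> s"
  obtains k where "\<sigma> k \<le> s" "s < \<sigma> (Suc k)"
proof -
  have "\<forall>\<^sub>F k in sequentially. s < \<sigma> k"
    using seq by (simp add: impulse_sequence_def filterlim_at_top_dense)
  then obtain k where "s < \<sigma> k" by (auto simp: eventually_sequentially)
  define m where "m = (LEAST k. s < \<sigma> k)"
  have m: "s < \<sigma> m" unfolding m_def by (rule LeastI) fact
  with assms obtain k where k: "m = Suc k" by (cases m) auto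
  have "\<not> s < \<sigma> k" using not_less_Least[of k "\<lambda>k. s < \<sigma> k"] k by (simp add: m_def)
  with m k that[of k] show thesis by simp
qed

lemma next_impulse_le:
  assumes "\<sigma> k \<le> s" "s < \<sigma> (Suc k)"
  shows "\<tau> \<in> impulses \<Longrightarrow> s < \<tau> \<Longrightarrow> \<sigma> (Suc k) \<le> \<tau>"
proof -
  assume "\<tau> \<in> impulses" "s < \<tau>"
  then obtain m where m: "\<tau> = \<sigma> m" by (auto simp: impulse_times_def)
  with assms \<open>s < \<tau>\<close> have "\<sigma> k < \<sigma> m" by simp
  then have "Suc k \<le> m" using strict_mono_less[OF strict_mono_\<sigma>] by simp
  then show ?thesis using strict_mono_less_eq[OF strict_mono_\<sigma>] m by simp
qed

lemma no_impulse_within: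
  assumes "\<sigma> k \<le> s" "t < \<sigma> (Suc k)"
  shows "impulses \<inter> {s<..t} = {}"
proof (cases "s < \<sigma> (Suc k)")
  case True
  have "\<not> \<tau> \<le> t" if "\<tau> \<in> impulses" "s < \<tau>" for \<tau>
    using next_impulse_le[OF assms(1) True that] assms(2) by simp
  then show ?thesis by auto
next
  case False
  with assms(2) have "t < s" by simp
  then show ?thesis by auto
qed

lemma U_flow: "impulses \<inter> {s<..t} = {} \<Longrightarrow> U t s = S (t - s)"
  by (simp add: propagator_def)

lemma U_self [simp]: "U s s = id_blinfun"
  by (simp add: U_flow)

lemma U_jump:
  assumes "\<tau> \<in> impulses" "s < \<tau>" "impulses \<inter> {s<..<\<tau>} = {}"
  shows "U \<tau> s = J o\<^sub>L S (\<tau> - s)"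
proof -
  have "impulses \<inter> {s<..\<tau>} = {\<tau>}"
    using assms by (auto simp: less_eq_real_def)
  then show ?thesis
    by (auto simp: propagator_def intro: blinfun_eqI)
qed

text \<open>The two lists are cut at a time \<open>r\<close> that is in general no impulse time, so that the semigroup
  factor straddling \<open>r\<close> has to be split in two.\<close>

lemma propagate_append:
  assumes "sorted (ys :: real list)" "\<And>y. y \<in> set ys \<Longrightarrow> r \<le> y \<and> y \<le> t" "r \<le> t"
    and "sorted xs" "\<And>x. x \<in> set xs \<Longrightarrow> s \<le> x \<and> x \<le> r" "s \<le> r"
  shows "propagate S J t s (xs @ ys) = propagate S J t r ys o\<^sub>L propagate S J r s xs"
  using assms(4-)
proof (induction xs arbitrary: s)
  case Nil
  show ?case
  proof (cases ys)
    case Nil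
    then show ?thesis using S_add[of "t - r" "r - s"] assms(3) \<open>s \<le> r\<close> by simp
  next
    case (Cons y ys')
    then have "S (y - s) = S (y - r) o\<^sub>L S (r - s)"
      using S_add[of "y - r" "r - s"] assms(2)[of y] \<open>s \<le> r\<close> by simp
    with Cons show ?thesis by (simp add: blinfun_compose_assoc)
  qed
next
  case (Cons x xs)
  then show ?case using Cons.IH[of x] by (simp add: blinfun_compose_assoc)
qed

lemma U_compose:
  assumes "s \<le> r" "r \<le> t"
  shows "U t s = U t r o\<^sub>L U r s"
proof -
  let ?A = "impulses \<inter> {s<..r}" and ?B = "impulses \<inter> {r<..t}"
  have "impulses \<inter> {s<..t} = ?A \<union> ?B" using assms by auto
  moreover have "sorted_list_of_set (?A \<union> ?B) = sorted_list_of_set ?A @ sorted_list_of_set ?B"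
  proof (rule sorted_distinct_set_unique)
    show "sorted (sorted_list_of_set ?A @ sorted_list_of_set ?B)"
      by (auto simp: sorted_append finite_impulses)
  qed (auto simp: finite_impulses)
  moreover have "propagate S J t s (sorted_list_of_set ?A @ sorted_list_of_set ?B) =
      propagate S J t r (sorted_list_of_set ?B) o\<^sub>L propagate S J r s (sorted_list_of_set ?A)"
    using assms by (intro propagate_append) (auto simp: finite_impulses)
  ultimately show ?thesis by (simp only: propagator_def)
qed

lemma U_apply_compose: "s \<le> r \<Longrightarrow> r \<le> t \<Longrightarrow> U t r (U r s x) = U t s x"
  by (simp add: U_compose[of s r t])

text \<open>Every time interval is a composition of impulse-free intervals and intervals whose only impulse
  sits at the right end, so that a property of pairs of times that respects composition need only be
  checked on these two kinds.\<close>

lemma evolution_induct [consumes 2, case_names trans flow jump]: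
  assumes "0 \<le> s" "s \<le> t"
    and trans: "\<And>s r t. 0 \<le> s \<Longrightarrow> s \<le> r \<Longrightarrow> r \<le> t \<Longrightarrow> P r s \<Longrightarrow> P t r \<Longrightarrow> P t s"
    and flow: "\<And>s t. 0 \<le> s \<Longrightarrow> s \<le> t \<Longrightarrow> impulses \<inter> {s<..t} = {} \<Longrightarrow> P t s"
    and jump: "\<And>s \<tau>. 0 \<le> s \<Longrightarrow> s < \<tau> \<Longrightarrow> \<tau> \<in> impulses \<Longrightarrow> impulses \<inter> {s<..<\<tau>} = {} \<Longrightarrow> P \<tau> s"
  shows "P t s"
  using assms(1,2)
proof (induction "card (impulses \<inter> {s<..t})" arbitrary: s rule: less_induct)
  case less
  show ?case
  proof (cases "impulses \<inter> {s<..t} = {}")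
    case True
    with less.prems show ?thesis by (rule flow)
  next
    case False
    define \<tau> where "\<tau> = Min (impulses \<inter> {s<..t})"
    have \<tau>: "\<tau> \<in> impulses \<inter> {s<..t}" unfolding \<tau>_def by (rule Min_in[OF finite_impulses False])
    have first: "\<tau> \<le> x" if "x \<in> impulses \<inter> {s<..t}" for x
      unfolding \<tau>_def by (rule Min_le[OF finite_impulses that])
    have "x \<notin> {s<..<\<tau>}" if "x \<in> impulses" for x
      using first[of x] that \<tau> by auto
    then have "P \<tau> s" using less.prems \<tau> by (intro jump) auto
    moreover have "impulses \<inter> {\<tau><..t} \<subset> impulses \<inter> {s<..t}" using \<tau> by auto
    then have "P t \<tau>" using \<tau> less.prems
      by (intro less.hyps psubset_card_mono finite_impulses) auto
    ultimately show ?thesis using less.prems \<tau> by (intro trans[of s \<tau> t]) auto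
  qed
qed

section \<open>Strong continuity and measurability of trajectories\<close>

text \<open>Half the infimal dwell-time is a safe length: it fits at most one impulse, and being
  strictly less than the supremal dwell-time it lies in the range on which the growth function \<open>g\<close>
  is known to be bounded. The bound on \<open>S\<close> follows as \<open>U\<close> started at time \<open>0\<close> is \<open>S\<close> up to the
  first impulse.\<close>

lemma short_time_bound:
  obtains h K where "0 < h" "1 \<le> K" "\<And>s t. 0 \<le> s \<Longrightarrow> s \<le> t \<Longrightarrow> t \<le> s + h \<Longrightarrow> norm (U t s) \<le> K"
    and "\<And>t. 0 \<le> t \<Longrightarrow> t \<le> h \<Longrightarrow> norm (S t) \<le> K"
proof -
  define h where "h = inf_dwell \<sigma> / 2"
  have h: "0 < h" using dwell by (simp add: h_def)
  have "bdd_below (range (\<lambda>k. \<sigma> (Suc k) - \<sigma> k))"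
    using strict_mono_\<sigma> by (intro bdd_belowI[of _ 0]) (auto simp: strict_mono_Suc_iff less_imp_le)
  then have gap: "2 * h \<le> \<sigma> (Suc k) - \<sigma> k" for k
    unfolding h_def inf_dwell_def by (auto intro: cINF_lower)
  have count: "impulse_count \<sigma> t s \<le> 1" if "0 \<le> s" "t \<le> s + h" for s t
  proof -
    obtain k where k: "\<sigma> k \<le> s" "s < \<sigma> (Suc k)" using current_interval \<open>0 \<le> s\<close> by blast
    have "impulses \<inter> {s<..t} \<subseteq> {\<sigma> (Suc k)}"
    proof
      fix \<tau> assume \<tau>: "\<tau> \<in> impulses \<inter> {s<..t}"
      have "\<not> \<sigma> (Suc k) < \<tau>"
      proof
        assume "\<sigma> (Suc k) < \<tau>"
        then have "\<sigma> (Suc (Suc k)) \<le> \<tau>"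
          using \<tau> strict_monoD[OF strict_mono_\<sigma>, of "Suc k" "Suc (Suc k)"]
          by (intro next_impulse_le[of "Suc k" "\<sigma> (Suc k)"]) auto
        with gap[of "Suc k"] k \<tau> that h show False by auto
      qed
      with next_impulse_le[OF k, of \<tau>] \<tau> show "\<tau> \<in> {\<sigma> (Suc k)}" by auto
    qed
    then have "card (impulses \<inter> {s<..t}) \<le> card {\<sigma> (Suc k)}" by (intro card_mono) auto
    then show ?thesis by (simp add: impulse_count_def)
  qed
  obtain g c\<^sub>0 \<mu> where g_pos: "0 < c\<^sub>0" "\<forall>\<tau>\<ge>0. c\<^sub>0 \<le> g \<tau>" and \<mu>: "1 < \<mu>"
    and U_le: "\<forall>s\<ge>0. \<forall>t\<ge>s. \<forall>x.
      norm (U t s x) \<le> g (t - s) * \<mu> ^ impulse_count \<sigma> t s * norm x"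
    and bdd: "bdd_above (g ` {\<tau>. 0 \<le> \<tau> \<and> ereal \<tau> < sup_dwell \<sigma>})"
    using growth unfolding growth_condition_def by blast
  obtain G where g_le: "g \<tau> \<le> G" if "0 \<le> \<tau>" "ereal \<tau> < sup_dwell \<sigma>" for \<tau>
    using bdd unfolding bdd_above_def by auto
  \<comment> \<open>one factor \<open>\<mu>\<close>, for the only impulse that the window can contain\<close>
  define K where "K = max 1 (G * \<mu>)"
  have K: "norm (U t s) \<le> K" if st: "0 \<le> s" "s \<le> t" "t \<le> s + h" for s t
  proof -
    have "ereal (t - s) < ereal (\<sigma> (Suc 0) - \<sigma> 0)" using gap[of 0] h st by simp
    also have "\<dots> \<le> sup_dwell \<sigma>" unfolding sup_dwell_def by (rule SUP_upper) simp
    finally have "g (t - s) \<le> G" using g_le[of "t - s"] st by simp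
    moreover have "\<mu> ^ impulse_count \<sigma> t s \<le> \<mu> ^ 1"
      using count st \<mu> by (intro power_increasing) auto
    ultimately have le: "g (t - s) * \<mu> ^ impulse_count \<sigma> t s \<le> G * \<mu>"
      using \<mu> g_pos(1) g_pos(2)[rule_format, of "t - s"] st by (intro mult_mono) auto
    show ?thesis
    proof (rule norm_blinfun_bound)
      fix x
      have "norm (U t s x) \<le> g (t - s) * \<mu> ^ impulse_count \<sigma> t s * norm x"
        using U_le st by simp
      also have "\<dots> \<le> K * norm x"
        using le by (intro mult_right_mono) (auto simp: K_def)
      finally show "norm (U t s x) \<le> K * norm x" .
    qed (simp add: K_def)
  qed
  have "norm (S t) \<le> K" if "0 \<le> t" "t \<le> h" for t
  proof -
    have "impulses \<inter> {0<..t} = {}"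
      using gap[of 0] h that by (intro no_impulse_within[of 0]) auto
    then show ?thesis using K[of 0 t] that U_flow[of 0 t] by simp
  qed
  with h K show thesis by (intro that[of h K]) (auto simp: K_def)
qed

text \<open>Left continuity needs a local bound on \<open>norm (S t)\<close>, as
  \<open>S a x - S b x = S a (x - S (b - a) x)\<close> for \<open>a < b\<close>; on \<open>{r..r + h}\<close> the bound
  \<open>norm (S r) * K\<close> with the \<open>K\<close> of \<open>short_time_bound\<close> serves.\<close>

lemma continuous_on_S: "continuous_on {0..} (\<lambda>t. S t x)"
proof -
  obtain h K where h: "0 < h" "1 \<le> K"
      "\<And>s t. 0 \<le> s \<Longrightarrow> s \<le> t \<Longrightarrow> t \<le> s + h \<Longrightarrow> norm (U t s) \<le> K"
      "\<And>t. 0 \<le> t \<Longrightarrow> t \<le> h \<Longrightarrow> norm (S t) \<le> K"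
    by (rule short_time_bound, rule that)
  have on_window: "continuous_on {r..r + h} (\<lambda>t. S t x)" if r: "0 \<le> r" for r
  proof (rule continuous_on_if_one_sided_modulus)
    let ?M = "norm (S r) * K"
    show "((\<lambda>u. ?M * norm (S u x - x)) \<longlongrightarrow> 0) (at_right 0)"
      using S_tendsto_0[of x] by (intro tendsto_mult_right_zero tendsto_norm_zero LIM_zero)
    fix a b assume ab: "a \<in> {r..r + h}" "b \<in> {r..r + h}" "a < b"
    have "S (a - r) (S (b - a) x) = S (b - r) x"
      using S_apply_diff[of 0 "b - a" "b - r" x] ab by simp
    moreover have "S r (S (a - r) x) = S a x" "S r (S (b - r) x) = S b x"
      using S_apply_diff[of 0 "a - r" a x] S_apply_diff[of 0 "b - r" b x] ab r by simp_all
    ultimately have "S a x - S b x = S r (S (a - r) (x - S (b - a) x))"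
      by (simp add: blinfun.diff_right)
    then have "norm (S a x - S b x) \<le> norm (S r) * norm (S (a - r) (x - S (b - a) x))"
      by (simp add: norm_blinfun)
    also have "\<dots> \<le> norm (S r) * (norm (S (a - r)) * norm (x - S (b - a) x))"
      by (intro mult_left_mono norm_blinfun) auto
    also have "\<dots> \<le> norm (S r) * (K * norm (x - S (b - a) x))"
      using h(4)[of "a - r"] ab by (intro mult_left_mono mult_right_mono) auto
    finally show "dist (S a x) (S b x) \<le> ?M * norm (S (b - a) x - x)"
      by (simp add: dist_norm norm_minus_commute mult.assoc)
  qed
  have "((\<lambda>t. S t x) \<longlongrightarrow> S t x) (at t within {0..})" if "0 \<le> t" for t
  proof -
    define r where "r = max 0 (t - h / 2)"
    have r: "0 \<le> r" "t \<in> {r..r + h}" using that h(1) by (auto simp: r_def)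
    have "at t within {0..} = at t within {r..r + h}"
      by (rule at_within_nhd[of t "{t - h / 2<..<t + h / 2}"])
         (use h(1) that in \<open>auto simp: r_def\<close>)
    with on_window[OF r(1)] r(2) show ?thesis by (simp add: continuous_on_def)
  qed
  then show ?thesis by (auto simp: continuous_on_def)
qed

lemma continuous_on_S_shift: "continuous_on {s..} (\<lambda>t. S (t - s) x)"
  by (rule continuous_on_compose2[OF continuous_on_S]) (auto intro!: continuous_intros)

lemma continuous_on_flow_powr:
  assumes "0 < p"
  shows "continuous_on {s..} (\<lambda>t. norm (S (t - s) x) powr p)"
  using assms
  by (intro continuous_on_powr'[OF continuous_on_norm[OF continuous_on_S_shift] continuous_on_const]) auto

lemma set_integrable_flow:
  assumes "0 < p"
  shows "set_integrable lborel {s..<t} (\<lambda>\<tau>. norm (S (\<tau> - s) x) powr p)"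
proof -
  have "continuous_on {s..t} (\<lambda>\<tau>. norm (S (\<tau> - s) x) powr p)"
    by (rule continuous_on_subset[OF continuous_on_flow_powr[OF assms]]) auto
  from borel_integrable_atLeastAtMost'[OF this] show ?thesis
    by (rule set_integrable_subset) auto
qed

lemma U_before_impulse:
  "impulses \<inter> {s<..<t} = {} \<Longrightarrow> \<tau> \<in> {s..<t} \<Longrightarrow> U \<tau> s = S (\<tau> - s)"
  by (rule U_flow) auto

lemma set_integrable_until_impulse:
  assumes "impulses \<inter> {s<..<t} = {}" "0 < p"
  shows "set_integrable lborel {s..<t} (\<lambda>\<tau>. norm (U \<tau> s x) powr p)"
proof -
  have "set_integrable lborel {s..<t} (\<lambda>\<tau>. norm (U \<tau> s x) powr p) =
      set_integrable lborel {s..<t} (\<lambda>\<tau>. norm (S (\<tau> - s) x) powr p)"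
    by (rule set_integrable_cong) (simp_all only: U_before_impulse[OF assms(1)])
  with set_integrable_flow[OF assms(2)] show ?thesis by blast
qed

text \<open>A trajectory jumps at impulse times, so its integrability, and with it its measurability, is
  assembled from the continuous pieces by \<open>evolution_induct\<close>.\<close>

lemma set_integrable_trajectory:
  assumes "0 \<le> s" "s \<le> t" "0 < p"
  shows "set_integrable lborel {s..<t} (\<lambda>\<tau>. norm (U \<tau> s x) powr p)"
  using assms(1,2)
proof (induction arbitrary: x rule: evolution_induct)
  case (trans s r t)
  have "set_integrable lborel {r..<t} (\<lambda>\<tau>. norm (U \<tau> s x) powr p) =
      set_integrable lborel {r..<t} (\<lambda>\<tau>. norm (U \<tau> r (U r s x)) powr p)"
    using trans.hyps by (intro set_integrable_cong) (auto simp: U_apply_compose)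
  then have "set_integrable lborel {r..<t} (\<lambda>\<tau>. norm (U \<tau> s x) powr p)"
    using trans.IH(2) by simp
  with trans.IH(1)[of x]
  have "set_integrable lborel ({s..<r} \<union> {r..<t}) (\<lambda>\<tau>. norm (U \<tau> s x) powr p)"
    by (rule set_integrable_Un) auto
  also have "{s..<r} \<union> {r..<t} = {s..<t}" using trans by auto
  finally show ?case .
next
  case (flow s t)
  then show ?case using assms(3) by (intro set_integrable_until_impulse) auto
next
  case (jump s t)
  then show ?case using assms(3) by (intro set_integrable_until_impulse) auto
qed

section \<open>Integral stability implies exponential stability\<close>

text \<open>Iterating the contraction gives \<open>q ^ n\<close> after time \<open>n * h\<close>, that is the rate \<open>- ln q / h\<close>; the
  incomplete last step costs a factor \<open>C / q\<close>.\<close>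

lemma exp_stable_if_contracting:
  assumes h: "0 < h" and q: "0 < q" "q < 1"
    and bounded: "\<And>s t. 0 \<le> s \<Longrightarrow> s \<le> t \<Longrightarrow> norm (U t s) \<le> C"
    and contr: "\<And>s. 0 \<le> s \<Longrightarrow> norm (U (s + h) s) \<le> q"
  shows "exp_stable S J \<sigma>"
proof -
  have iterate: "norm (U (s + real n * h) s) \<le> q ^ n" if "0 \<le> s" for n s
  proof (induction n)
    case 0
    show ?case using norm_blinfun_id_le by simp
  next
    case (Suc n)
    let ?r = "s + real n * h"
    have "U (s + real (Suc n) * h) s = U (?r + h) ?r o\<^sub>L U ?r s"
      using U_compose[of s ?r "?r + h"] h by (simp add: algebra_simps)
    then have "norm (U (s + real (Suc n) * h) s) \<le> norm (U (?r + h) ?r) * norm (U ?r s)"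
      by (simp add: norm_blinfun_compose)
    also have "\<dots> \<le> q * q ^ n"
      using Suc contr[of ?r] that h q by (intro mult_mono) auto
    finally show ?case by simp
  qed
  have C: "0 \<le> C" using bounded[of 0 0] norm_ge_zero[of "U 0 0"] by linarith
  define \<alpha> where "\<alpha> = - ln q / h"
  have \<alpha>: "0 < \<alpha>" using h q by (simp add: \<alpha>_def divide_neg_pos)
  have "norm (U t s) \<le> max 1 (C / q) * exp (- \<alpha> * (t - s))" if st: "0 \<le> s" "s \<le> t" for s t
  proof -
    define n where "n = nat \<lfloor>(t - s) / h\<rfloor>"
    have n: "real n \<le> (t - s) / h" "(t - s) / h < real n + 1"
      using st h by (auto simp: n_def of_nat_nat)
    let ?r = "s + real n * h"
    have r: "s \<le> ?r" "?r \<le> t" using n(1) h by (auto simp: field_simps)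
    have "norm (U t s) \<le> norm (U t ?r) * norm (U ?r s)"
      unfolding U_compose[OF r] by (rule norm_blinfun_compose)
    also have "\<dots> \<le> C * q ^ n"
      using bounded[of ?r t] iterate[of s n] r st C by (intro mult_mono) auto
    also have "q ^ n = exp (real n * ln q)"
      using q by (simp add: exp_of_nat_mult)
    also have "\<dots> \<le> exp (((t - s) / h - 1) * ln q)"
      using n(2) q by (intro iffD2[OF exp_le_cancel_iff] mult_right_mono_neg) auto
    also have "\<dots> = exp (- \<alpha> * (t - s)) / q"
    proof -
      have "((t - s) / h - 1) * ln q = - \<alpha> * (t - s) - ln q"
        using h by (simp add: \<alpha>_def algebra_simps)
      then show ?thesis using q by (simp add: exp_diff)
    qed
    also have "C * (exp (- \<alpha> * (t - s)) / q) = C / q * exp (- \<alpha> * (t - s))" by simp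
    also have "\<dots> \<le> max 1 (C / q) * exp (- \<alpha> * (t - s))"
      by (intro mult_right_mono) auto
    finally show ?thesis using C by (simp add: mult_left_mono)
  qed
  with \<alpha> show ?thesis
    unfolding exp_stable_def by (intro exI[of _ "max 1 (C / q)"] exI[of _ \<alpha>] conjI) auto
qed

text \<open>Datko's averaging step: \<open>norm (U t s x) / C\<close> is a lower bound for the trajectory on
  \<open>{a..<t}\<close>, and the integral over that window is at most \<open>(b * norm x) powr p\<close>.\<close>

lemma norm_U_le_by_averaging:
  assumes p: "1 \<le> p" and b: "0 < b" and C: "0 < C" and st: "0 \<le> s" "s \<le> a" "a < t"
    and int: "\<And>x. set_integrable lborel {s..} (\<lambda>\<tau>. norm (U \<tau> s x) powr p)"
    and le: "\<And>x. (LINT \<tau>:{s..}|lborel. norm (U \<tau> s x) powr p) \<le> b powr p * norm x powr p"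
    and bound: "\<And>\<tau>. a \<le> \<tau> \<Longrightarrow> \<tau> < t \<Longrightarrow> norm (U t \<tau>) \<le> C"
  shows "norm (U t s) \<le> C * b / (t - a) powr (1 / p)"
proof (rule norm_blinfun_bound)
  fix x
  let ?u = "norm (U t s x)" and ?\<delta> = "(t - a) powr (1 / p)"
  have "(?u / C) powr p \<le> norm (U \<tau> s x) powr p" if \<tau>: "a \<le> \<tau>" "\<tau> < t" for \<tau>
  proof -
    have "?u = norm (U t \<tau> (U \<tau> s x))" using st \<tau> by (simp add: U_apply_compose)
    also have "\<dots> \<le> norm (U t \<tau>) * norm (U \<tau> s x)" by (rule norm_blinfun)
    also have "\<dots> \<le> C * norm (U \<tau> s x)" using bound[OF \<tau>] by (intro mult_right_mono) auto
    finally have "?u / C \<le> norm (U \<tau> s x)" using C by (simp add: divide_le_eq mult.commute)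
    then show ?thesis using p C by (intro powr_mono2) auto
  qed
  then have "(t - a) * (?u / C) powr p \<le> (LINT \<tau>:{s..}|lborel. norm (U \<tau> s x) powr p)"
    using st by (intro length_mult_le_set_integral int) auto
  also note le
  finally have "(?\<delta> * (?u / C)) powr p \<le> (b * norm x) powr p"
    using p b C st by (simp add: powr_mult[of ?\<delta> "?u / C"] powr_mult[of b] powr_powr del: times_divide_eq_right)
  then have "?\<delta> * (?u / C) \<le> b * norm x"
    using p b C by (subst (asm) powr_le_powr_iff) auto
  then show "?u \<le> C * b / ?\<delta> * norm x"
    using C st by (simp add: field_simps)
qed (use b C in simp)

text \<open>The averaging step is used twice: with a short window, where \<open>K\<close> is available, to bound \<open>U\<close>
  uniformly, and then with the whole interval as window.\<close>

lemma exp_stable_if_integrally_stable: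
  assumes "integrally_stable S J \<sigma>"
  shows "exp_stable S J \<sigma>"
proof -
  obtain p b where p: "1 \<le> p" and b: "0 < b"
    and int: "\<And>s x. 0 \<le> s \<Longrightarrow> set_integrable lborel {s..} (\<lambda>t. norm (U t s x) powr p)"
    and le: "\<And>s x. 0 \<le> s \<Longrightarrow>
      (LINT t:{s..}|lborel. norm (U t s x) powr p) \<le> b powr p * norm x powr p"
    using assms unfolding integrally_stable_def by blast
  obtain h K where h: "0 < h" and K: "1 \<le> K"
      "\<And>s t. 0 \<le> s \<Longrightarrow> s \<le> t \<Longrightarrow> t \<le> s + h \<Longrightarrow> norm (U t s) \<le> K"
    by (rule short_time_bound, rule that)
  define C where "C = max K (K * b / h powr (1 / p))"
  have C: "0 < C" using K(1) by (simp add: C_def)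
  have bounded: "norm (U t s) \<le> C" if st: "0 \<le> s" "s \<le> t" for s t
  proof (cases "t \<le> s + h")
    case True
    then show ?thesis using K(2)[of s t] st by (simp add: C_def)
  next
    case False
    have "norm (U t s) \<le> K * b / (t - (t - h)) powr (1 / p)"
      using False st h K(1) p b int[OF st(1)] le[OF st(1)]
      by (intro norm_U_le_by_averaging K(2)) auto
    then show ?thesis by (simp add: C_def)
  qed
  \<comment> \<open>chosen so that the averaging bound over a window of length \<open>H\<close> is exactly \<open>1 / 2\<close>\<close>
  define H where "H = (2 * C * b) powr p"
  have H: "0 < H" "H powr (1 / p) = 2 * C * b"
    using C b p by (auto simp: H_def powr_powr)
  have "norm (U (s + H) s) \<le> 1 / 2" if "0 \<le> s" for s
  proof -
    have "norm (U (s + H) s) \<le> C * b / (s + H - s) powr (1 / p)"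
      using that H(1) p b C int[OF that] le[OF that]
      by (intro norm_U_le_by_averaging bounded) auto
    then show ?thesis using H(2) C b by simp
  qed
  then show ?thesis
    by (intro exp_stable_if_contracting[OF H(1), of "1 / 2" C] bounded) auto
qed

section \<open>Dissipation along trajectories of a Lyapunov functional\<close>

text \<open>The Dini derivative of \<open>V\<close> along the flow and the ordinary derivative of the integral cancel, so
  their sum satisfies the hypothesis of \<open>nonincreasing_if_lower_dini_nonpos\<close>.\<close>

lemma lyapunov_decay_along_flow:
  assumes lyap: "lyapunov_functional S J \<sigma> p c V" and p: "1 \<le> p"
    and st: "0 \<le> s" "s \<le> t" and free: "impulses \<inter> {s<..t} = {}"
  shows "V t (S (t - s) y) + integral {s..t} (\<lambda>\<tau>. norm (S (\<tau> - s) y) powr p) \<le> V s y"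
proof -
  define x where "x u = S (u - s) y" for u
  define f where "f \<tau> = norm (x \<tau>) powr p" for \<tau>
  obtain k where k: "\<sigma> k \<le> s" "s < \<sigma> (Suc k)" using current_interval[OF st(1)] .
  have "\<sigma> (Suc k) \<in> impulses" by (simp add: impulse_times_def)
  with free k have tk: "t < \<sigma> (Suc k)" by (auto simp: not_le)
  have lip: "uniformly_lipschitz_on_bounded V"
    and Vcont: "continuous_on {\<sigma> k..<\<sigma> (Suc k)} (\<lambda>u. V u z)"
    and dini: "0 \<le> u \<Longrightarrow> lower_dini S V u z \<le> ereal (- (norm z powr p))" for u z
    using lyap by (auto simp: lyapunov_functional_def piecewise_right_continuous_def)
  have xcont: "continuous_on {s..t} x"
    unfolding x_def by (rule continuous_on_subset[OF continuous_on_S_shift]) auto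
  have fcont: "continuous_on {s..t} f"
    unfolding f_def x_def using p
    by (intro continuous_on_subset[OF continuous_on_flow_powr]) auto
  have "continuous_on {s..t} (\<lambda>u. V u (x u))"
    unfolding continuous_on_def
  proof
    fix u assume u: "u \<in> {s..t}"
    have "continuous_on {s..t} (\<lambda>v. V v (x u))"
      using k tk by (intro continuous_on_subset[OF Vcont]) auto
    with u have V: "((\<lambda>v. V v (x u)) \<longlongrightarrow> V u (x u)) (at u within {s..t})"
      by (simp add: continuous_on_def)
    have x: "(x \<longlongrightarrow> x u) (at u within {s..t})"
      using xcont u by (simp add: continuous_on_def)
    have nonneg: "\<forall>\<^sub>F v in at u within {s..t}. 0 \<le> v"
      using st(1) by (auto simp: eventually_at_topological)
    show "((\<lambda>u. V u (x u)) \<longlongrightarrow> V u (x u)) (at u within {s..t})"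
      by (rule tendsto_along_trajectory[OF lip nonneg x V])
  qed
  moreover have "continuous_on {s..t} (\<lambda>u. integral {s..u} f)"
    by (intro indefinite_integral_continuous_1 integrable_continuous_real fcont)
  ultimately have "continuous_on {s..t} (\<lambda>u. V u (x u) + integral {s..u} f)"
    by (rule continuous_on_add)
  moreover have "\<exists>\<^sub>F v in at_right u.
      (V v (x v) + integral {s..v} f - (V u (x u) + integral {s..u} f)) / (v - u) < \<epsilon>"
    if u: "s \<le> u" "u < t" and \<epsilon>: "0 < \<epsilon>" for u \<epsilon>
  proof -
    have "\<exists>\<^sub>F h in at_right 0. (V (u + h) (S h (x u)) - V u (x u)) / h < - f u + \<epsilon> / 2"
      using dini[of u "x u"] u st \<epsilon> unfolding lower_dini_def f_def
      by (intro frequently_lt_if_Liminf_le) auto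
    then have "\<exists>\<^sub>F v in at_right u. (V v (S (v - u) (x u)) - V u (x u)) / (v - u) < - f u + \<epsilon> / 2"
      by (simp add: frequently_def eventually_at_right_to_0[of _ u] add.commute)
    moreover have "((\<lambda>v. integral {s..v} f) has_real_derivative f u) (at u within {u..t})"
      using u by (intro DERIV_subset[OF integral_has_real_derivative[OF fcont]]) auto
    then have "((\<lambda>v. (integral {s..v} f - integral {s..u} f) / (v - u)) \<longlongrightarrow> f u) (at_right u)"
      using u by (simp add: has_field_derivative_iff at_within_Icc_at_right)
    then have "\<forall>\<^sub>F v in at_right u. (integral {s..v} f - integral {s..u} f) / (v - u) < f u + \<epsilon> / 2"
      by (rule order_tendstoD) (use \<epsilon> in simp)
    moreover have "\<forall>\<^sub>F v in at_right u. u < v" by (simp add: eventually_at_filter)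
    \<comment> \<open>the bound on the quotients of \<open>V\<close> holds only frequently, that for the integral
      eventually; so both hold together frequently\<close>
    ultimately have "\<exists>\<^sub>F v in at_right u.
        (V v (S (v - u) (x u)) - V u (x u)) / (v - u) < - f u + \<epsilon> / 2 \<and>
        (integral {s..v} f - integral {s..u} f) / (v - u) < f u + \<epsilon> / 2 \<and> u < v"
      by (intro frequently_eventually_frequently eventually_conj)
    then show ?thesis
    proof (rule frequently_elim1)
      fix v
      assume v: "(V v (S (v - u) (x u)) - V u (x u)) / (v - u) < - f u + \<epsilon> / 2 \<and>
        (integral {s..v} f - integral {s..u} f) / (v - u) < f u + \<epsilon> / 2 \<and> u < v"
      then have "S (v - u) (x u) = x v" using u by (simp add: x_def S_apply_diff)
      with v show "(V v (x v) + integral {s..v} f - (V u (x u) + integral {s..u} f)) / (v - u) < \<epsilon>"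
        by (simp add: add_divide_distrib diff_divide_distrib)
    qed
  qed
  ultimately have "V t (x t) + integral {s..t} f \<le> V s (x s) + integral {s..s} f"
    by (rule nonincreasing_if_lower_dini_nonpos[OF st(2)])
  then show ?thesis by (simp add: x_def f_def[abs_def])
qed

text \<open>The decay up to times just before \<open>\<tau>\<close> passes to the limit; along the trajectory \<open>V\<close> converges to
  its left limit at the fixed state \<open>S (\<tau> - s) y\<close>, which is what the jump condition speaks about.\<close>

lemma lyapunov_decay_across_impulse:
  assumes lyap: "lyapunov_functional S J \<sigma> p c V" and p: "1 \<le> p"
    and s: "0 \<le> s" "s < \<tau>" and \<tau>: "\<tau> \<in> impulses" and free: "impulses \<inter> {s<..<\<tau>} = {}"
  shows "V \<tau> (J (S (\<tau> - s) y)) + integral {s..\<tau>} (\<lambda>u. norm (S (u - s) y) powr p) \<le> V s y"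
proof -
  let ?x = "\<lambda>u. S (u - s) y"
  let ?f = "\<lambda>u. norm (?x u) powr p"
  have lip: "uniformly_lipschitz_on_bounded V"
    and ex: "\<exists>l. ((\<lambda>u. V u (?x \<tau>)) \<longlongrightarrow> l) (at_left \<tau>)"
    and jump: "V \<tau> (J (?x \<tau>)) - Lim (at_left \<tau>) (\<lambda>u. V u (?x \<tau>)) \<le> 0"
    using lyap \<tau> by (auto simp: lyapunov_functional_def piecewise_right_continuous_def)
  from ex obtain l where l: "((\<lambda>u. V u (?x \<tau>)) \<longlongrightarrow> l) (at_left \<tau>)" ..
  have near: "\<forall>\<^sub>F u in at_left \<tau>. u \<in> {s<..<\<tau>}" using eventually_at_left_real[OF s(2)] .
  have x: "(?x \<longlongrightarrow> ?x \<tau>) (at_left \<tau>)"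
    by (rule continuous_on_Icc_at_leftD[OF continuous_on_subset[OF continuous_on_S_shift] s(2)]) auto
  have nonneg: "\<forall>\<^sub>F u in at_left \<tau>. 0 \<le> u" using near by eventually_elim (use s in auto)
  have "((\<lambda>u. V u (?x u)) \<longlongrightarrow> l) (at_left \<tau>)"
    by (rule tendsto_along_trajectory[OF lip nonneg x l])
  moreover have "continuous_on {s..\<tau>} ?f"
    using p by (intro continuous_on_subset[OF continuous_on_flow_powr]) auto
  then have "((\<lambda>u. integral {s..u} ?f) \<longlongrightarrow> integral {s..\<tau>} ?f) (at_left \<tau>)"
    by (intro continuous_on_Icc_at_leftD[OF indefinite_integral_continuous_1 s(2)]
        integrable_continuous_real)
  ultimately have "((\<lambda>u. V u (?x u) + integral {s..u} ?f) \<longlongrightarrow> l + integral {s..\<tau>} ?f) (at_left \<tau>)"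
    by (rule tendsto_add)
  moreover have "\<forall>\<^sub>F u in at_left \<tau>. V u (?x u) + integral {s..u} ?f \<le> V s y"
    using near
  proof eventually_elim
    case (elim u)
    then have "impulses \<inter> {s<..u} = {}" using free by auto
    then show ?case using elim s by (intro lyapunov_decay_along_flow[OF lyap p]) auto
  qed
  ultimately have "l + integral {s..\<tau>} ?f \<le> V s y"
    by (rule tendsto_upperbound) simp
  moreover have "V \<tau> (J (?x \<tau>)) \<le> l" using jump tendsto_Lim[OF _ l] by simp
  ultimately show ?thesis by simp
qed

lemma trajectory_integral_until_impulse:
  assumes "impulses \<inter> {s<..<t} = {}" "0 < p"
  shows "(LINT \<tau>:{s..<t}|lborel. norm (U \<tau> s x) powr p)
       \<le> integral {s..t} (\<lambda>\<tau>. norm (S (\<tau> - s) x) powr p)"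
proof -
  let ?f = "\<lambda>\<tau>. norm (S (\<tau> - s) x) powr p"
  have "continuous_on {s..t} ?f"
    by (rule continuous_on_subset[OF continuous_on_flow_powr[OF assms(2)]]) auto
  note int = borel_integrable_atLeastAtMost'[OF this]
  have "(LINT \<tau>:{s..<t}|lborel. norm (U \<tau> s x) powr p) = (LINT \<tau>:{s..<t}|lborel. ?f \<tau>)"
    by (intro set_lebesgue_integral_cong) (auto simp: U_before_impulse[OF assms(1)])
  also have "\<dots> \<le> (LINT \<tau>:{s..t}|lborel. ?f \<tau>)"
    by (rule set_integral_mono_subset[OF int]) auto
  also have "\<dots> = integral {s..t} ?f" by (rule set_borel_integral_eq_integral[OF int])
  finally show ?thesis .
qed

lemma lyapunov_dissipation:
  assumes lyap: "lyapunov_functional S J \<sigma> p c V" and p: "1 \<le> p" and "0 \<le> s" "s \<le> t"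
  shows "V t (U t s x) + (LINT \<tau>:{s..<t}|lborel. norm (U \<tau> s x) powr p) \<le> V s x"
  using assms(3,4)
proof (induction arbitrary: x rule: evolution_induct)
  case (trans s r t)
  have int: "set_integrable lborel {s..<t} (\<lambda>\<tau>. norm (U \<tau> s x) powr p)"
    using trans.hyps p by (intro set_integrable_trajectory) auto
  have "(LINT \<tau>:{r..<t}|lborel. norm (U \<tau> r (U r s x)) powr p)
      = (LINT \<tau>:{r..<t}|lborel. norm (U \<tau> s x) powr p)"
    using trans.hyps by (intro set_lebesgue_integral_cong) (auto simp: U_apply_compose)
  moreover have "(LINT \<tau>:{s..<r} \<union> {r..<t}|lborel. norm (U \<tau> s x) powr p)
      = (LINT \<tau>:{s..<r}|lborel. norm (U \<tau> s x) powr p) + (LINT \<tau>:{r..<t}|lborel. norm (U \<tau> s x) powr p)"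
    using trans.hyps by (intro set_integral_Un set_integrable_subset[OF int]) auto
  moreover have "{s..<r} \<union> {r..<t} = {s..<t}" using trans.hyps by auto
  ultimately show ?case
    using trans.IH(1)[of x] trans.IH(2)[of "U r s x"] trans.hyps by (simp add: U_apply_compose)
next
  case (flow s t)
  then have "impulses \<inter> {s<..<t} = {}" by auto
  with flow p lyapunov_decay_along_flow[OF lyap p, of s t x] show ?case
    using trajectory_integral_until_impulse[of s t p x] by (simp add: U_flow)
next
  case (jump s t)
  with p lyapunov_decay_across_impulse[OF lyap p, of s t x] show ?case
    using trajectory_integral_until_impulse[of s t p x] by (simp add: U_jump)
qed

text \<open>Dropping the nonnegative term \<open>V t (U t s x)\<close> from the dissipation inequality leaves a bound on
  the integral that is uniform in \<open>t\<close>.\<close>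

lemma integrally_stable_if_lyapunov:
  assumes lyap: "lyapunov_functional S J \<sigma> p c V" and p: "1 \<le> p" and c: "0 < c"
  shows "integrally_stable S J \<sigma>"
proof -
  have V: "0 \<le> V t x" "V t x \<le> c * norm x powr p" if "0 \<le> t" for t x
    using lyap that by (auto simp: lyapunov_functional_def)
  have "set_integrable lborel {s..} (\<lambda>t. norm (U t s x) powr p) \<and>
      (LINT t:{s..}|lborel. norm (U t s x) powr p) \<le> (c powr (1 / p)) powr p * norm x powr p"
    if s: "0 \<le> s" for s x
  proof -
    have int: "set_integrable lborel {s..<t} (\<lambda>t. norm (U t s x) powr p)" if "s \<le> t" for t
      using s that p by (intro set_integrable_trajectory) auto
    have "(LINT \<tau>:{s..<t}|lborel. norm (U \<tau> s x) powr p) \<le> c * norm x powr p" if "s \<le> t" for t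
      using lyapunov_dissipation[OF lyap p s that, of x] V(1)[of t "U t s x"] V(2)[OF s, of x] s that
      by simp
    from halfline_integrable_if_bounded[OF int _ this] show ?thesis
      using p c by (simp add: powr_powr)
  qed
  then show ?thesis
    unfolding integrally_stable_def using p c
    by (intro exI[of _ p] exI[of _ "c powr (1 / p)"] conjI) auto
qed

end

section \<open>The integral functional of an exponentially stable system\<close>

locale exp_stable_system = impulsive_system +
  fixes M \<alpha> p :: real
  assumes M: "1 \<le> M" and \<alpha>: "0 < \<alpha>" and p: "1 \<le> p"
    and decay: "\<And>s t. 0 \<le> s \<Longrightarrow> s \<le> t \<Longrightarrow> norm (U t s) \<le> M * exp (- \<alpha> * (t - s))"
begin

abbreviation V :: "real \<Rightarrow> 'a \<Rightarrow> real" where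
  "V \<equiv> integral_functional S J \<sigma> p"

abbreviation E :: "real \<Rightarrow> real \<Rightarrow> real" where
  "E s t \<equiv> exp (- (\<alpha> * p) * (t - s))"

lemma \<alpha>p: "0 < \<alpha> * p"
  using \<alpha> p by simp

lemma norm_U_apply_le:
  assumes "0 \<le> s" "s \<le> t"
  shows "norm (U t s x) \<le> M * exp (- \<alpha> * (t - s)) * norm x"
  by (rule norm_blinfun[THEN order_trans], intro mult_right_mono decay assms) simp

lemma norm_U_apply_le_M:
  assumes "0 \<le> s" "s \<le> t"
  shows "norm (U t s x) \<le> M * norm x"
proof -
  have "exp (- \<alpha> * (t - s)) \<le> 1" using \<alpha> assms by simp
  then have "M * exp (- \<alpha> * (t - s)) * norm x \<le> M * 1 * norm x"
    using M by (intro mult_mono) auto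
  with norm_U_apply_le[OF assms, of x] show ?thesis by simp
qed

lemma exp_powr_p: "exp (- \<alpha> * (t - s)) powr p = E s t"
  by (simp add: exp_powr_real mult.assoc mult.left_commute)

lemma norm_U_powr_le:
  assumes "0 \<le> s" "s \<le> t"
  shows "norm (U t s x) powr p \<le> (M * norm x) powr p * E s t"
proof -
  have "norm (U t s x) powr p \<le> (M * norm x * exp (- \<alpha> * (t - s))) powr p"
    using norm_U_apply_le[OF assms, of x] p by (intro powr_mono2) (auto simp: mult_ac)
  also have "\<dots> = (M * norm x) powr p * E s t"
    by (simp only: powr_mult[of "M * norm x"] exp_powr_p)
  finally show ?thesis .
qed

lemma integral_E_le:
  assumes "0 \<le> k"
  shows "set_integrable lborel {s..} (\<lambda>t. k * E s t)"
    and "(LINT t:{s..}|lborel. k * E s t) \<le> k / (\<alpha> * p)"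
  using exp_decay_halfline_integral[OF \<alpha>p, of s] mult_left_mono[OF _ assms]
  by (auto simp: divide_inverse)

lemma trajectory_integral_le:
  assumes s: "0 \<le> s"
  shows "set_integrable lborel {s..} (\<lambda>t. norm (U t s x) powr p)"
    and "V s x \<le> (M * norm x) powr p / (\<alpha> * p)"
proof -
  let ?f = "\<lambda>t. norm (U t s x) powr p" and ?k = "(M * norm x) powr p"
  have int: "set_integrable lborel {s..<t} ?f" if "s \<le> t" for t
    using s that p by (intro set_integrable_trajectory) auto
  have bound: "(LINT \<tau>:{s..<t}|lborel. ?f \<tau>) \<le> ?k / (\<alpha> * p)" if "s \<le> t" for t
  proof -
    have E: "set_integrable lborel {s..} (\<lambda>\<tau>. ?k * E s \<tau>)" by (rule integral_E_le) simp
    have "(LINT \<tau>:{s..<t}|lborel. ?f \<tau>) \<le> (LINT \<tau>:{s..<t}|lborel. ?k * E s \<tau>)"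
      using norm_U_powr_le[OF s]
      by (intro set_integral_mono int that set_integrable_subset[OF E]) auto
    also have "\<dots> \<le> (LINT \<tau>:{s..}|lborel. ?k * E s \<tau>)"
      by (rule set_integral_mono_subset[OF E]) auto
    also have "\<dots> \<le> ?k / (\<alpha> * p)" by (rule integral_E_le) simp
    finally show ?thesis .
  qed
  show "set_integrable lborel {s..} ?f"
    by (rule halfline_integrable_if_bounded[OF int _ bound]) auto
  have "(LINT \<tau>:{s..}|lborel. ?f \<tau>) \<le> ?k / (\<alpha> * p)"
    by (rule halfline_integrable_if_bounded[OF int _ bound]) auto
  then show "V s x \<le> ?k / (\<alpha> * p)" by (simp add: integral_functional_def)
qed

lemma V_nonneg: "0 \<le> V t x"
  unfolding integral_functional_def set_lebesgue_integral_def
  by (rule integral_nonneg_AE) simp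

text \<open>On the ball of radius \<open>r\<close> both trajectories stay below \<open>M * exp (- \<alpha> * (s - t)) * r\<close>, so the
  \<open>p\<close>-th powers differ by at most \<open>p\<close> times the power \<open>p - 1\<close> of this bound times the distance of
  the trajectories, which decays in the same way. The exponents add up to \<open>p\<close>.\<close>

lemma V_lipschitz:
  assumes t: "0 \<le> t" and xy: "norm x \<le> r" "norm y \<le> r"
  shows "\<bar>V t x - V t y\<bar> \<le> M powr p * r powr (p - 1) / \<alpha> * norm (x - y)"
proof -
  have one_sided: "V t x - V t y \<le> M powr p * r powr (p - 1) / \<alpha> * norm (x - y)"
    if xy: "norm x \<le> r" "norm y \<le> r" for x y
  proof -
    have r: "0 \<le> r" using xy(1) norm_ge_zero[of x] by linarith
    let ?k = "p * M powr p * r powr (p - 1) * norm (x - y)"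
    have k: "0 \<le> ?k" using p by simp
    have "norm (U s t x) powr p - norm (U s t y) powr p \<le> ?k * E t s" if s: "t \<le> s" for s
    proof -
      let ?m = "M * exp (- \<alpha> * (s - t))"
      have m: "0 < ?m" using M by simp
      have "norm (U s t z) \<le> ?m * r" if "norm z \<le> r" for z
        using norm_U_apply_le[OF t s, of z] mult_left_mono[OF that, of ?m] m by linarith
      then have "norm (U s t x) powr p - norm (U s t y) powr p
          \<le> p * (?m * r) powr (p - 1) * \<bar>norm (U s t x) - norm (U s t y)\<bar>"
        using abs_powr_diff_le[OF p norm_ge_zero _ norm_ge_zero] xy
        by (meson abs_ge_self order_trans)
      also have "\<dots> \<le> p * (?m * r) powr (p - 1) * (?m * norm (x - y))"
      proof (intro mult_left_mono)
        have "\<bar>norm (U s t x) - norm (U s t y)\<bar> \<le> norm (U s t (x - y))"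
          by (simp add: blinfun.diff_right norm_triangle_ineq3)
        also have "\<dots> \<le> ?m * norm (x - y)" by (rule norm_U_apply_le[OF t s])
        finally show "\<bar>norm (U s t x) - norm (U s t y)\<bar> \<le> ?m * norm (x - y)" .
      qed (use p in simp)
      also have "p * (?m * r) powr (p - 1) * (?m * norm (x - y))
          = p * (?m powr (p - 1) * ?m) * r powr (p - 1) * norm (x - y)"
        using m r by (simp only: powr_mult mult_ac)
      also have "?m powr (p - 1) * ?m = ?m powr p"
        using m powr_add[of ?m "p - 1" 1] by simp
      also have "?m powr p = M powr p * E t s"
        using M by (simp only: powr_mult exp_powr_p)
      finally show ?thesis by (simp only: mult_ac)
    qed
    then have "(LINT s:{t..}|lborel. norm (U s t x) powr p - norm (U s t y) powr p)
        \<le> (LINT s:{t..}|lborel. ?k * E t s)"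
      by (intro set_integral_mono set_integral_diff trajectory_integral_le integral_E_le t k) auto
    also have "\<dots> \<le> ?k / (\<alpha> * p)" by (rule integral_E_le[OF k])
    also have "\<dots> = M powr p * r powr (p - 1) / \<alpha> * norm (x - y)"
      using p by simp
    finally show ?thesis
      by (simp add: integral_functional_def set_integral_diff trajectory_integral_le t)
  qed
  show ?thesis
    using one_sided[OF xy] one_sided[OF xy(2,1)] by (simp add: abs_le_iff norm_minus_commute)
qed

lemma V_split:
  assumes tu: "0 \<le> t" "t \<le> u"
  shows "V t x = (LINT s:{t..<u}|lborel. norm (U s t x) powr p) + V u (U u t x)"
proof -
  let ?f = "\<lambda>s. norm (U s t x) powr p"
  have int: "set_integrable lborel {t..} ?f" using tu(1) by (rule trajectory_integral_le)
  have "{t..} = {t..<u} \<union> {u..}" using tu by auto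
  then have "V t x = (LINT s:{t..<u} \<union> {u..}|lborel. ?f s)"
    by (simp add: integral_functional_def)
  also have "\<dots> = (LINT s:{t..<u}|lborel. ?f s) + (LINT s:{u..}|lborel. ?f s)"
    using tu by (intro set_integral_Un set_integrable_subset[OF int]) auto
  also have "(LINT s:{u..}|lborel. ?f s) = V u (U u t x)"
    unfolding integral_functional_def
    using tu by (intro set_lebesgue_integral_cong) (auto simp: U_apply_compose)
  finally show ?thesis .
qed

lemma V_drift:
  assumes tu: "0 \<le> t" "t \<le> u"
  shows "\<bar>V t x - V u (U u t x)\<bar> \<le> (u - t) * (M * norm x) powr p"
proof -
  let ?f = "\<lambda>s. norm (U s t x) powr p"
  have int: "set_integrable lborel {t..<u} ?f"
    using tu p by (intro set_integrable_trajectory) auto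
  have "(LINT s:{t..<u}|lborel. ?f s) \<le> (LINT s:{t..<u}|lborel. (M * norm x) powr p)"
  proof (intro set_integral_mono int)
    show "set_integrable lborel {t..<u} (\<lambda>_. (M * norm x) powr p)"
      unfolding set_integrable_def
      using tu by (intro integrable_scaleR_left integrable_real_indicator) auto
    show "?f s \<le> (M * norm x) powr p" if "s \<in> {t..<u}" for s
      using that tu p by (intro powr_mono2 norm_U_apply_le_M) auto
  qed
  also have "\<dots> = (u - t) * (M * norm x) powr p"
    using tu by (simp add: set_lebesgue_integral_def)
  finally have "(LINT s:{t..<u}|lborel. ?f s) \<le> (u - t) * (M * norm x) powr p" .
  moreover have "0 \<le> (LINT s:{t..<u}|lborel. ?f s)"
    unfolding set_lebesgue_integral_def by (rule integral_nonneg_AE) simp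
  ultimately show ?thesis using V_split[OF tu, of x] by simp
qed

text \<open>From \<open>t\<close> to \<open>u\<close> the value first drifts along the flow and then moves from the state
  \<open>S (u - t) x\<close> back to \<open>x\<close>; for fixed \<open>x\<close> both errors depend on \<open>u - t\<close> only.\<close>

lemma V_continuous_between_impulses: "continuous_on {\<sigma> k..<\<sigma> (Suc k)} (\<lambda>t. V t x)"
proof (rule continuous_on_if_one_sided_modulus)
  let ?D = "(M * norm x) powr p" and ?L = "M powr p * (M * norm x) powr (p - 1) / \<alpha>"
  let ?\<eta> = "\<lambda>v. v * ?D + ?L * norm (S v x - x)"
  show "(?\<eta> \<longlongrightarrow> 0) (at_right 0)"
    using S_tendsto_0[of x]
    by (intro tendsto_add_zero tendsto_mult_left_zero tendsto_mult_right_zero tendsto_norm_zero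
        LIM_zero tendsto_ident_at)
  fix t u assume tu: "t \<in> {\<sigma> k..<\<sigma> (Suc k)}" "u \<in> {\<sigma> k..<\<sigma> (Suc k)}" "t < u"
  then have t: "0 \<le> t" using \<sigma>_nonneg[of k] by simp
  have U: "U u t = S (u - t)"
    using tu by (intro U_flow no_impulse_within[of k]) auto
  have "norm x \<le> M * norm x" using M mult_right_mono[of 1 M "norm x"] by simp
  then have "\<bar>V u (S (u - t) x) - V u x\<bar> \<le> ?L * norm (S (u - t) x - x)"
    using t tu norm_U_apply_le_M[of t u x] by (intro V_lipschitz) (auto simp: U)
  moreover have "\<bar>V t x - V u (S (u - t) x)\<bar> \<le> (u - t) * ?D"
    using V_drift[of t u x] t tu by (simp add: U)
  ultimately show "dist (V t x) (V u x) \<le> ?\<eta> (u - t)"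
    by (simp add: dist_real_def)
qed

text \<open>Just before the impulse the trajectory from \<open>x\<close> is about to be mapped to \<open>J x\<close>, so the
  functional already looks past the jump.\<close>

lemma V_left_limit_at_impulse:
  assumes "\<tau> \<in> impulses"
  shows "((\<lambda>t. V t x) \<longlongrightarrow> V \<tau> (J x)) (at_left \<tau>)"
proof -
  obtain m where "1 \<le> m" "\<tau> = \<sigma> m" using assms by (auto simp: impulse_times_def)
  then obtain k where \<tau>: "\<tau> = \<sigma> (Suc k)" by (cases m) auto
  have k: "\<sigma> k < \<tau>" unfolding \<tau> by (rule strict_monoD[OF strict_mono_\<sigma>]) simp
  \<comment> \<open>a radius that covers \<open>J x\<close> and all states \<open>U \<tau> t x\<close> at the impulse\<close>
  define r where "r = max (M * norm x) (norm (J x))"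
  let ?D = "(M * norm x) powr p" and ?L = "M powr p * r powr (p - 1) / \<alpha>"
  let ?\<eta> = "\<lambda>v. v * ?D + ?L * norm (J (S v x - x))"
  have "(?\<eta> \<longlongrightarrow> 0) (at_right 0)"
    using S_tendsto_0[of x]
    by (intro tendsto_add_zero tendsto_mult_left_zero tendsto_mult_right_zero tendsto_norm_zero
        bounded_linear.tendsto_zero[OF blinfun.bounded_linear_right] LIM_zero tendsto_ident_at)
  from filterlim_compose[OF this filterlim_diff_at_left]
  have lim: "((\<lambda>t. ?\<eta> (\<tau> - t)) \<longlongrightarrow> 0) (at_left \<tau>)" .
  have le: "norm (V t x - V \<tau> (J x)) \<le> ?\<eta> (\<tau> - t)" if t: "\<sigma> k < t" "t < \<tau>" for t
  proof -
    have t0: "0 \<le> t" using t \<sigma>_nonneg[of k] by simp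
    have "impulses \<inter> {t<..<\<tau>} = {}"
      using next_impulse_le[of k t] t \<tau> by force
    then have U: "U \<tau> t = J o\<^sub>L S (\<tau> - t)" using t assms by (intro U_jump)
    have "\<bar>V \<tau> (J (S (\<tau> - t) x)) - V \<tau> (J x)\<bar> \<le> ?L * norm (J (S (\<tau> - t) x) - J x)"
      using norm_U_apply_le_M[of t \<tau> x] t t0
      by (intro V_lipschitz) (auto simp: U r_def)
    moreover have "\<bar>V t x - V \<tau> (J (S (\<tau> - t) x))\<bar> \<le> (\<tau> - t) * ?D"
      using V_drift[of t \<tau> x] t t0 by (simp add: U)
    ultimately show ?thesis by (simp add: blinfun.diff_right)
  qed
  have "\<forall>\<^sub>F t in at_left \<tau>. norm (V t x - V \<tau> (J x)) \<le> ?\<eta> (\<tau> - t)"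
    using eventually_at_left_real[OF k] by eventually_elim (rule le; simp)
  from Lim_null_comparison[OF this lim] show ?thesis by (rule LIM_zero_cancel)
qed

text \<open>The increment of \<open>V\<close> along the flow is minus an integral over \<open>{t..<t + h}\<close>, whose integrand is
  close to \<open>norm x powr p\<close> for small \<open>h\<close>. At an impulse time this remains true because \<open>U s t\<close>
  counts impulses in the half-open interval \<open>{t<..s}\<close>.\<close>

lemma V_lower_dini:
  assumes t: "0 \<le> t"
  shows "lower_dini S V t x \<le> ereal (- (norm x powr p))"
  unfolding lower_dini_def
proof (rule Liminf_le_if_eventually_le)
  fix \<epsilon> :: real assume "0 < \<epsilon>"
  obtain k where k: "\<sigma> k \<le> t" "t < \<sigma> (Suc k)" using current_interval[OF t] .
  have "((\<lambda>h. norm (S h x) powr p) \<longlongrightarrow> norm x powr p) (at_right 0)"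
    using p by (intro tendsto_powr' tendsto_norm S_tendsto_0 tendsto_const) auto
  then have "\<forall>\<^sub>F h in at_right 0. norm x powr p - \<epsilon> < norm (S h x) powr p"
    by (rule order_tendstoD) (use \<open>0 < \<epsilon>\<close> in linarith)
  then obtain d where d: "0 < d"
      "\<And>h. 0 < h \<Longrightarrow> h < d \<Longrightarrow> norm x powr p - \<epsilon> < norm (S h x) powr p"
    by (auto simp: eventually_at_right_field)
  have "(V (t + h) (S h x) - V t x) / h \<le> - (norm x powr p) + \<epsilon>"
    if h: "0 < h" "h < min d (\<sigma> (Suc k) - t)" for h
  proof -
    have U: "U s t = S (s - t)" if "t \<le> s" "s \<le> t + h" for s
      using h k that by (intro U_flow no_impulse_within[of k]) auto
    have "norm x powr p - \<epsilon> \<le> norm (U s t x) powr p" if s: "t \<le> s" "s < t + h" for s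
      using d(2)[of "s - t"] s h \<open>0 < \<epsilon>\<close> by (cases "s = t") (auto simp: U)
    then have "(t + h - t) * (norm x powr p - \<epsilon>) \<le> (LINT s:{t..<t + h}|lborel. norm (U s t x) powr p)"
      using t h p by (intro length_mult_le_set_integral set_integrable_trajectory) auto
    then have "V (t + h) (S h x) - V t x \<le> h * (- (norm x powr p) + \<epsilon>)"
      using V_split[of t "t + h" x] t h U[of "t + h"] by (simp add: algebra_simps)
    then show ?thesis using h by (simp add: divide_le_eq mult.commute)
  qed
  then show "\<forall>\<^sub>F h in at_right 0. (V (t + h) (S h x) - V t x) / h \<le> - (norm x powr p) + \<epsilon>"
    using d(1) k(2)
    by (intro eventually_at_right_field[THEN iffD2] exI[of _ "min d (\<sigma> (Suc k) - t)"]) auto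
qed simp

lemma lyapunov_integral_functional:
  "lyapunov_functional S J \<sigma> p (M powr p / (\<alpha> * p)) V"
  unfolding lyapunov_functional_def
proof (intro conjI allI impI ballI)
  show "uniformly_lipschitz_on_bounded V"
    unfolding uniformly_lipschitz_on_bounded_def
  proof (intro allI impI)
    fix r :: real assume "0 < r"
    show "\<exists>L>0. \<forall>t\<ge>0. \<forall>x y. norm x < r \<longrightarrow> norm y < r \<longrightarrow>
        \<bar>V t x - V t y\<bar> \<le> L * norm (x - y)"
    proof (intro exI[of _ "M powr p * r powr (p - 1) / \<alpha>"] conjI allI impI)
      show "0 < M powr p * r powr (p - 1) / \<alpha>" using M \<alpha> \<open>0 < r\<close> by simp
    qed (rule V_lipschitz, auto)
  qed
  show "piecewise_right_continuous \<sigma> V"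
    unfolding piecewise_right_continuous_def
    using V_continuous_between_impulses V_left_limit_at_impulse by blast
  show "V t (J x) - Lim (at_left t) (\<lambda>\<tau>. V \<tau> x) \<le> 0" if "t \<in> impulses" for t x
    using tendsto_Lim[OF _ V_left_limit_at_impulse[OF that, of x]] by simp
  show "V t x \<le> M powr p / (\<alpha> * p) * norm x powr p" if "0 \<le> t" for t x
    using trajectory_integral_le(2)[OF that, of x] M by (simp add: powr_mult)
qed (simp_all add: V_nonneg V_lower_dini)

end

section \<open>The equivalence\<close>

theorem theorem4p3:
  fixes A :: "'a::banach \<Rightarrow> 'a" and DA :: "'a set"
    and S :: "real \<Rightarrow> 'a \<Rightarrow>\<^sub>L 'a" and J :: "'a \<Rightarrow>\<^sub>L 'a"
    and \<sigma> :: "nat \<Rightarrow> real"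
  assumes "generates DA A S"
    and "J \<noteq> 0"
    and "blinfun_apply J ` DA \<subseteq> DA"
    and "impulse_sequence \<sigma>"
    and "inf_dwell \<sigma> > 0"
    and "growth_condition S J \<sigma>"
  shows "(exp_stable S J \<sigma> \<longleftrightarrow> integrally_stable S J \<sigma>) \<and>
    (integrally_stable S J \<sigma> \<longleftrightarrow>
       (\<exists>V. \<exists>p\<ge>1. \<exists>c>0. lyapunov_functional S J \<sigma> p c V)) \<and>
    (exp_stable S J \<sigma> \<longrightarrow>
       (\<forall>p\<ge>1.
          (\<forall>t\<ge>0. \<forall>x. set_integrable lborel {t..} (\<lambda>s. norm (propagator S J \<sigma> s t x) powr p)) \<and>
          (\<exists>c>0. lyapunov_functional S J \<sigma> p c (integral_functional S J \<sigma> p))))"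
proof -
  interpret impulsive_system S J \<sigma>
    using assms by unfold_locales (auto simp: generates_def)
  let ?lyapunov = "\<exists>V. \<exists>p\<ge>1. \<exists>c>0. lyapunov_functional S J \<sigma> p c V"
  have explicit: "(\<forall>t\<ge>0. \<forall>x. set_integrable lborel {t..} (\<lambda>s. norm (U s t x) powr p)) \<and>
      (\<exists>c>0. lyapunov_functional S J \<sigma> p c (integral_functional S J \<sigma> p))"
    if stable: "exp_stable S J \<sigma>" and p: "1 \<le> p" for p
  proof -
    obtain M \<alpha> where "1 \<le> M" "0 < \<alpha>"
        "\<forall>s\<ge>0. \<forall>t\<ge>s. norm (U t s) \<le> M * exp (- \<alpha> * (t - s))"
      using stable unfolding exp_stable_def by blast
    then interpret exp_stable_system S J \<sigma> M \<alpha> p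
      using p by unfold_locales auto
    have "0 < M powr p / (\<alpha> * p)" using M \<alpha>p by simp
    with lyapunov_integral_functional trajectory_integral_le(1) show ?thesis by blast
  qed
  \<comment> \<open>any exponent is possible here; \<open>p = 1\<close> is as good as any other\<close>
  have "?lyapunov" if "exp_stable S J \<sigma>"
    using explicit[OF that, of 1] by (intro exI[of _ "integral_functional S J \<sigma> 1"] exI[of _ 1]) simp
  moreover have "integrally_stable S J \<sigma>" if ?lyapunov
    using that integrally_stable_if_lyapunov by blast
  ultimately show ?thesis
    using exp_stable_if_integrally_stable explicit by blast
qed

end
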